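(* Let $p$ be an odd prime and $m$ a positive integer with $p^m\equiv 3\pmod 4$, $n=2m$. Let $b\in\mathbb{F}_{p^2}^*$, let $l$ be an integer with $\gcd(l,\frac{p^m+1}{4})=1$ and $4\mid l$, let $k$ be a positive integer with $k\equiv 1$ or $3\pmod 4$, and let $a=\overline{a}\xi^k$ with $\overline{a}\in\mathbb{F}_{p^m}^*$. Define $f:\mathbb{F}_{p^n}\to\mathbb{F}_p$ by $$f(x)={\rm Tr}_1^n\big(ax^{l(p^m-1)}\big)+{\rm Tr}_1^2\big(bx^{\frac{p^n-1}{4}}\big).$$ Then $f$ is regular bent if and only if $$K_m(\overline{a}^2)=1-4I\sqrt{-1}\sin\frac{2\pi Q(\overline{a})}{p}-\frac{2}{\cos\frac{2\pi{\rm Tr}_1^2(b)}{p}+\cos\frac{2\pi{\rm Tr}_1^2(b\xi^{\frac{p^m+1}{4}})}{p}}.$$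
   Context: $\omega=e^{2\pi\sqrt{-1}/p}$. ${\rm Tr}_k^t$ is the trace map from $\mathbb{F}_{p^t}$ to $\mathbb{F}_{p^k}$. $\xi$ is a fixed generator of the cyclic group $U=\{x\in\mathbb{F}_{p^n}:x^{p^m+1}=1\}$. $K_m(\beta)=\sum_{x\in\mathbb{F}_{p^m}}\omega^{{\rm Tr}_1^m(\beta x+x^{p^m-2})}$. For a nonzero square $c$ of $\mathbb{F}_{p^n}$, $Q(c)=2{\rm Tr}_1^m\big(c^{\frac{p^m+1}{2}}\big)$ (here $Q(\overline{a})$ is taken as an integer in $\{0,\dots,p-1\}$). $I=\frac{(-1)^{3m/2}p^{m/2}}{2}$ if $p\equiv 3\pmod 4$ and $I=\frac{(-1)^m p^{m/2}}{2}$ otherwise, with $(-1)^{3m/2}=e^{3m\pi\sqrt{-1}/2}$. For $f:\mathbb{F}_{p^n}\to\mathbb{F}_p$, $W_f(\lambda)=\sum_{x}\omega^{f(x)-{\rm Tr}_1^n(\lambda x)}$; $f$ is regular bent if for every $\lambda$, $W_f(\lambda)=p^{n/2}\omega^{f^*(\lambda)}$ for some function $f^*:\mathbb{F}_{p^n}\to\mathbb{F}_p$. *)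

theory Defs
  imports Complex_Main "HOL-Computational_Algebra.Primes"
begin

text \<open>Finite fields are modelled as a finite field type 'a with CARD('a) = p^n.
  Subfields F_{p^k} are the sets {x. x^(p^k) = x}; the prime field F_p is {of_nat i | i < p}.\<close>

definition subfield_pk :: "nat \<Rightarrow> nat \<Rightarrow> 'a::field set" where
  "subfield_pk p k = {x. x ^ (p ^ k) = x}"

definition tr :: "nat \<Rightarrow> nat \<Rightarrow> nat \<Rightarrow> 'a::field \<Rightarrow> 'a" where
  "tr p k t x = (\<Sum>i<t div k. x ^ (p ^ (k * i)))"

definition fp_val :: "nat \<Rightarrow> 'a::field \<Rightarrow> nat" where
  "fp_val p x = (THE i. i < p \<and> of_nat i = x)"

definition omega :: "nat \<Rightarrow> nat \<Rightarrow> complex" where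
  "omega p j = cis (2 * pi * real j / real p)"

definition Kloost :: "nat \<Rightarrow> nat \<Rightarrow> 'a::{field,finite} \<Rightarrow> complex" where
  "Kloost p m \<beta> = (\<Sum>x\<in>subfield_pk p m.
      omega p (fp_val p (tr p 1 m (\<beta> * x + x ^ (p ^ m - 2)))))"

definition Qfun :: "nat \<Rightarrow> nat \<Rightarrow> 'a::field \<Rightarrow> nat" where
  "Qfun p m c = fp_val p (2 * tr p 1 m (c ^ ((p ^ m + 1) div 2)))"

definition Iconst :: "nat \<Rightarrow> nat \<Rightarrow> complex" where
  "Iconst p m = (if p mod 4 = 3
     then cis (3 * real m * pi / 2) * complex_of_real (sqrt (real p ^ m)) / 2
     else (-1) ^ m * complex_of_real (sqrt (real p ^ m)) / 2)"

definition walsh :: "nat \<Rightarrow> nat \<Rightarrow> ('a::{field,finite} \<Rightarrow> 'a) \<Rightarrow> 'a \<Rightarrow> complex" where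
  "walsh p n f lam = (\<Sum>x\<in>UNIV. omega p (fp_val p (f x - tr p 1 n (lam * x))))"

text \<open>f takes values in F_p (represented inside 'a).\<close>
definition regular_bent :: "nat \<Rightarrow> nat \<Rightarrow> ('a::{field,finite} \<Rightarrow> 'a) \<Rightarrow> bool" where
  "regular_bent p n f \<longleftrightarrow> (\<exists>fstar :: 'a \<Rightarrow> 'a. (\<forall>y. fstar y \<in> subfield_pk p 1) \<and>
     (\<forall>lam. walsh p n f lam = complex_of_real (sqrt (real p ^ n)) * omega p (fp_val p (fstar lam))))"

end

theory Submission
  imports Defs "Jordan_Normal_Form.Determinant"
begin

text \<open>
  Write \<open>q = p ^ m\<close>, so that \<open>p \<equiv> 3 (mod 4)\<close> and \<open>m\<close> is odd. Away from \<open>0\<close>, \<open>f\<close> is a function \<open>g\<close> of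
  \<open>x ^ (q - 1)\<close>, and Dillon's argument shows that \<open>f\<close> is regular bent iff the sum \<open>S\<close> of the values
  \<open>\<omega> ^ g u\<close> over the group \<open>U\<close> of order \<open>q + 1\<close> equals \<open>1\<close>. As \<open>4\<close> divides \<open>l\<close> and \<open>l\<close> is coprime to
  \<open>N = (q + 1) / 4\<close>, the number \<open>N\<close> is odd, \<open>U\<close> is the product of its subgroups of orders \<open>N\<close> and \<open>4\<close>, and
  \<open>S\<close> factors accordingly. The factor of order \<open>4\<close> is twice the sum of cosines. The other one is half
  the sum of \<open>\<psi> (c (z + 1 / z))\<close> over the nonsquares \<open>z\<close> of \<open>U\<close>; these are described by the quadratic
  characters of \<open>t + 2\<close> and \<open>t - 2\<close> for \<open>t = z + 1 / z\<close>, which expresses the sum by \<open>K_m (c^2)\<close> and the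
  quadratic Gauss sum of the field with \<open>q\<close> elements. The latter is the \<open>m\<close>-th power of the Gauss sum of the prime field,
  because the trace form has square discriminant for odd \<open>m\<close>; the sign over the prime field is determined by Gauss'
  q-binomial identity.
\<close>


section \<open>The sign of the quadratic Gauss sum\<close>

text \<open>\<open>Iconst\<close> enters the criterion as it stands, not through its square, so the
  sign of the Gauss sum really matters. To pass from the prime field to the field with q elements,
  the quadratic form sending x to Tr(x^2) is diagonalised over the prime field: every orthogonal
  vector contributes one prime Gauss sum, and the characters left over multiply to the character of
  the discriminant. From S = 1 to bentness the Walsh values are simply read off. The converse needs
  an estimate: the Walsh values at 0 and 1 give 1 - z0 = (q - 1)(z1 - w) with p-th roots of unity
  z0, z1, w, and distinct p-th roots of unity are too far apart for this unless z1 = w. The sine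
  arises because the character sums belonging to t + 2 and t - 2 are shifts of one another; the
  shifts produce the factors psi(-2c) and psi(2c), which occur with opposite signs. The division by
  the sum of cosines is legitimate because the sum over the fourth roots of unity cannot vanish for
  odd p.\<close>

fun qbinom :: "'a::comm_ring_1 \<Rightarrow> nat \<Rightarrow> nat \<Rightarrow> 'a" where
  "qbinom x n 0 = 1"
| "qbinom x 0 (Suc k) = 0"
| "qbinom x (Suc n) (Suc k) = qbinom x n k + x ^ Suc k * qbinom x n (Suc k)"

lemma qbinom_eq_0: "n < k \<Longrightarrow> qbinom x n k = 0"
  by (induction x n k rule: qbinom.induct) auto

text \<open>The mirror image of the defining q-Pascal rule. Recursion without denominators keeps
  everything meaningful when \<open>x\<close> is a root of unity; writing the row as
  \<open>k + j\<close> avoids truncated subtraction.\<close>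

lemma qbinom_Suc_Suc':
  "qbinom x (Suc (k + j)) (Suc k) = x ^ j * qbinom x (k + j) k + qbinom x (k + j) (Suc k)"
proof (induction "k + j" arbitrary: k j)
  case 0
  then show ?case by simp
next
  case (Suc n)
  show ?case
  proof (cases k)
    case 0
    then obtain j' where j: "j = Suc j'" using Suc by (cases j) auto
    have "qbinom x (Suc j') (Suc 0) = x ^ j' * qbinom x j' 0 + qbinom x j' (Suc 0)"
      using Suc(1)[of 0 j'] Suc(2) 0 j by simp
    then show ?thesis by (simp add: 0 j algebra_simps)
  next
    case k: (Suc k')
    show ?thesis
    proof (cases j)
      case 0
      then show ?thesis by (simp add: qbinom_eq_0)
    next
      case j: (Suc j')
      have 1: "qbinom x (Suc (k + j')) (Suc k) = x ^ j' * qbinom x (k + j') k + qbinom x (k + j') (Suc k)"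
        using Suc(1)[of k j'] Suc(2) j by simp
      have 2: "qbinom x (Suc (k + j')) k = x ^ j * qbinom x (k + j') k' + qbinom x (k + j') k"
        using Suc(1)[of k' j] Suc(2) k j by simp
      have 3: "qbinom x (Suc (k + j')) k = qbinom x (k + j') k' + x ^ k * qbinom x (k + j') k"
        unfolding k by simp
      have 4: "qbinom x (Suc (k + j')) (Suc k) = qbinom x (k + j') k + x ^ Suc k * qbinom x (k + j') (Suc k)"
        by simp
      have "qbinom x (Suc (k + j)) (Suc k) = qbinom x (Suc (k + j')) k + x ^ Suc k * qbinom x (Suc (k + j')) (Suc k)"
        unfolding j by simp
      also have "\<dots> = x ^ j * qbinom x (Suc (k + j')) k + qbinom x (Suc (k + j')) (Suc k)"
        unfolding 1
        apply (subst 2) apply (subst 3) apply (subst (2) 1[symmetric]) apply (subst 4)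
        by (simp add: j algebra_simps power_add)
      finally show ?thesis by (simp add: j)
    qed
  qed
qed

text \<open>The two Pascal rules compared for the same entry: a division-free ratio of neighbours
  within a row.\<close>

lemma qbinom_step_lower:
  "(1 - x ^ j) * qbinom x (k + j) k = (1 - x ^ Suc k) * qbinom x (k + j) (Suc k)"
  using qbinom_Suc_Suc'[of x k j] by (simp add: algebra_simps)

text \<open>A division-free ratio of neighbours within a column, from the defining recursion and
  \<open>qbinom_step_lower\<close>.\<close>

lemma qbinom_step_upper:
  "(1 - x ^ Suc j) * qbinom x (Suc (k + j)) k = (1 - x ^ Suc (k + j)) * qbinom x (k + j) k"
proof (cases k)
  case 0
  then show ?thesis by simp
next
  case (Suc k')
  have E: "(1 - x ^ Suc j) * qbinom x (k + j) k' = (1 - x ^ k) * qbinom x (k + j) k"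
    using qbinom_step_lower[of x "Suc j" k'] by (simp add: Suc)
  have "qbinom x (Suc (k + j)) k = qbinom x (k + j) k' + x ^ k * qbinom x (k + j) k"
    by (simp add: Suc)
  then have "(1 - x ^ Suc j) * qbinom x (Suc (k + j)) k =
     (1 - x ^ k) * qbinom x (k + j) k + (1 - x ^ Suc j) * (x ^ k * qbinom x (k + j) k)"
    using E by (simp add: distrib_left)
  also have "\<dots> = (1 - x ^ Suc (k + j)) * qbinom x (k + j) k"
    by (simp add: algebra_simps power_add)
  finally show ?thesis .
qed

text \<open>Under the second Pascal rule the terms \<open>qbinom x n (Suc k)\<close> rebuild the
  alternating sum of row \<open>n\<close>; the other terms carry \<open>x ^ (n - k)\<close> and the
  opposite sign.\<close>

lemma alternating_qbinom_sum_Suc: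
  "(\<Sum>k\<le>Suc n. (-1) ^ k * qbinom x (Suc n) k) = (\<Sum>k\<le>n. (-1) ^ k * ((1 - x ^ (n - k)) * qbinom x n k))"
proof -
  have eq: "qbinom x (Suc n) (Suc k) = x ^ (n - k) * qbinom x n k + qbinom x n (Suc k)" if "k \<le> n" for k
    using qbinom_Suc_Suc'[of x k "n - k"] that by simp
  have "(\<Sum>k\<le>Suc n. (-1) ^ k * qbinom x (Suc n) k) = 1 + (\<Sum>k\<le>n. (-1) ^ Suc k * qbinom x (Suc n) (Suc k))"
    by (subst sum.atMost_Suc_shift) simp
  also have "\<dots> = 1 + (\<Sum>k\<le>n. (-1) ^ Suc k * qbinom x n (Suc k)) - (\<Sum>k\<le>n. (-1) ^ k * (x ^ (n - k) * qbinom x n k))"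
    unfolding add_diff_eq[symmetric] sum_subtractf[symmetric]
    by (intro arg_cong2[of _ _ _ _ "(+)"] refl sum.cong) (simp add: eq algebra_simps del: qbinom.simps)
  also have "1 + (\<Sum>k\<le>n. (-1) ^ Suc k * qbinom x n (Suc k)) = (\<Sum>k\<le>Suc n. (-1) ^ k * qbinom x n k)"
    by (subst sum.atMost_Suc_shift) simp
  also have "\<dots> = (\<Sum>k\<le>n. (-1) ^ k * qbinom x n k)"
    by (simp add: qbinom_eq_0)
  finally show ?thesis
    by (simp add: sum_subtractf[symmetric] algebra_simps)
qed

text \<open>The factor \<open>1 - x ^ (n - k)\<close> from \<open>alternating_qbinom_sum_Suc\<close>
  is what \<open>qbinom_step_upper\<close> needs to descend one more row, so two rows are removed at
  the price of a single factor with odd exponent.\<close>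

lemma gauss_qbinom_sum:
  "(\<Sum>k\<le>2 * h. (-1) ^ k * qbinom x (2 * h) k) = (\<Prod>j<h. 1 - x ^ (2 * j + 1))"
proof (induction h)
  case 0
  then show ?case by simp
next
  case (Suc h)
  have "(\<Sum>k\<le>2 * Suc h. (-1) ^ k * qbinom x (2 * Suc h) k) =
    (\<Sum>k\<le>Suc (2 * h). (-1) ^ k * ((1 - x ^ (Suc (2 * h) - k)) * qbinom x (Suc (2 * h)) k))"
    using alternating_qbinom_sum_Suc[of x "Suc (2 * h)"] by simp
  also have "\<dots> = (\<Sum>k\<le>2 * h. (-1) ^ k * ((1 - x ^ (Suc (2 * h) - k)) * qbinom x (Suc (2 * h)) k))"
    by simp
  also have "\<dots> = (\<Sum>k\<le>2 * h. (1 - x ^ Suc (2 * h)) * ((-1) ^ k * qbinom x (2 * h) k))"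
  proof (intro sum.cong refl)
    fix k assume "k \<in> {..2 * h}"
    then have "(1 - x ^ (Suc (2 * h) - k)) * qbinom x (Suc (2 * h)) k = (1 - x ^ Suc (2 * h)) * qbinom x (2 * h) k"
      using qbinom_step_upper[of x "2 * h - k" k] by (simp add: Suc_diff_le)
    then show "(-1) ^ k * ((1 - x ^ (Suc (2 * h) - k)) * qbinom x (Suc (2 * h)) k) =
      (1 - x ^ Suc (2 * h)) * ((-1) ^ k * qbinom x (2 * h) k)" by (simp only: mult_ac)
  qed
  also have "\<dots> = (1 - x ^ Suc (2 * h)) * (\<Prod>j<h. 1 - x ^ (2 * j + 1))"
    by (simp only: sum_distrib_left[symmetric] Suc.IH)
  finally show ?case by (simp add: mult.commute)
qed

section \<open>Roots of unity and Gauss' product formula\<close>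

lemma omega_add: "omega p (i + j) = omega p i * omega p j"
  by (simp add: omega_def cis_mult add_divide_distrib ring_distribs)

lemma omega_mult: "omega p (i * j) = omega p i ^ j"
  by (simp add: omega_def DeMoivre mult_ac)

lemma omega_0: "omega p 0 = 1"
  by (simp add: omega_def)

lemma omega_self: "p > 0 \<Longrightarrow> omega p p = 1"
  by (simp add: omega_def)

lemma omega_mod: "p > 0 \<Longrightarrow> omega p (i mod p) = omega p i"
proof -
  assume p: "p > 0"
  have "omega p i = omega p (p * (i div p) + i mod p)" by (simp only: mult_div_mod_eq)
  also have "\<dots> = omega p (i mod p)" unfolding omega_add omega_mult by (simp add: omega_self p)
  finally show ?thesis by simp
qed

lemma omega_nonzero: "omega p i \<noteq> 0"
  by (simp add: omega_def)

lemma omega_eq_1_iff: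
  assumes "p > 0"
  shows "omega p i = 1 \<longleftrightarrow> p dvd i"
proof
  assume "omega p i = 1"
  then have "cis (2 * pi * real i / real p) = 1" by (simp add: omega_def)
  then have "cos (2 * pi * real i / real p) = 1" by (metis cis.sel(1) one_complex.sel(1))
  then obtain z :: int where "2 * pi * real i / real p = of_int z * 2 * pi" by (auto simp: cos_one_2pi_int)
  then have "real i = of_int z * real p" using assms by (simp add: field_simps)
  then have "int i = z * int p" by (metis of_int_eq_iff of_int_mult of_int_of_nat_eq)
  then show "p dvd i" by (metis dvd_triv_right int_dvd_int_iff)
next
  assume "p dvd i"
  then show "omega p i = 1" using assms by (auto simp: dvd_def omega_mult omega_self)
qed

text \<open>The summand has period \<open>p\<close> in \<open>k\<close>, so a unit shift only trades
  the term at 0 for the term at \<open>p\<close>. This permits completing the square.\<close>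

lemma omega_shift_sum:
  assumes "p > 0"
  shows "(\<Sum>k<p. omega p ((k + s) ^ 2)) = (\<Sum>k<p. omega p (k ^ 2))"
proof (induction s)
  case 0
  then show ?case by simp
next
  case (Suc s)
  define \<phi> where "\<phi> k = omega p ((k + s) ^ 2)" for k
  have "(p + s) ^ 2 = p * (p + 2 * s) + s ^ 2"
    by (simp add: power2_eq_square algebra_simps)
  then have "\<phi> p = \<phi> 0"
    by (simp only: \<phi>_def omega_add omega_mult[of p p] omega_self[OF assms]) simp
  moreover have "(\<Sum>k<Suc p. \<phi> k) = \<phi> 0 + (\<Sum>k<p. \<phi> (Suc k))"
    by (rule sum.lessThan_Suc_shift)
  ultimately have "(\<Sum>k<p. \<phi> (Suc k)) = (\<Sum>k<p. \<phi> k)"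
    by simp
  then show ?case by (simp add: \<phi>_def Suc.IH)
qed

text \<open>Gauss' evaluation: at a root of unity of order \<open>2 h + 1\<close> the q-binomial coefficients
  \<open>[2 h, k]\<close> become \<open>(-1)^k\<close> times a root of unity with exponent quadratic in \<open>k\<close>.\<close>

lemma gauss_sum_product:
  fixes h :: nat
  defines "p \<equiv> 2 * h + 1"
  shows "(\<Sum>k<p. omega p (k ^ 2)) = (\<Prod>j<h. 2 * \<i> * complex_of_real (sin (2 * pi * real (2 * j + 1) / real p)))"
proof -
  have p: "p > 0" by (simp add: p_def)
  \<comment> \<open>\<open>x\<close> is the inverse square of the basic root of unity. The square
    makes the exponents add up to \<open>k * (k + 1)\<close>, which a shift by 1/2 completes to a
    square.\<close>
  define x where "x = cnj (omega p 2)"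
  have xw: "x ^ j * omega p (2 * j) = 1" for j
  proof -
    have "x ^ j * omega p (2 * j) = (x * omega p 2) ^ j" by (simp add: omega_mult power_mult_distrib)
    also have "x * omega p 2 = 1" by (simp add: x_def omega_def cis_cnj cis_mult)
    finally show ?thesis by simp
  qed
  have x1: "x ^ j = 1 \<longleftrightarrow> p dvd j" for j
  proof -
    have "x ^ j = 1 \<longleftrightarrow> omega p (2 * j) = 1" using xw[of j] by (metis mult.left_neutral mult.right_neutral)
    also have "\<dots> \<longleftrightarrow> p dvd 2 * j" by (rule omega_eq_1_iff[OF p])
    also have "\<dots> \<longleftrightarrow> p dvd j" by (rule coprime_dvd_mult_right_iff) (simp add: p_def)
    finally show ?thesis .
  qed
  have q: "qbinom x (2 * h) k = (-1) ^ k * omega p (k * (k + 1))" if "k \<le> 2 * h" for k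
    using that
  proof (induction k)
    case 0
    then show ?case by (simp add: omega_0)
  next
    case (Suc k)
    have ne: "1 - x ^ Suc k \<noteq> 0" using x1[of "Suc k"] Suc.prems by (auto simp: p_def dest!: dvd_imp_le)
    \<comment> \<open>As \<open>x\<close> has order \<open>2 * h + 1\<close>, the powers
      \<open>x ^ (2 * h - k)\<close> and \<open>x ^ Suc k\<close> are inverse, and the ratio of
      neighbours in the row collapses to a root of unity up to sign.\<close>
    have xp: "x ^ (2 * h - k) * x ^ Suc k = 1"
    proof -
      have "x ^ (2 * h - k) * x ^ Suc k = x ^ p" unfolding power_add[symmetric] using Suc.prems by (simp add: p_def)
      then show ?thesis using x1[of p] by simp
    qed
    have "x ^ (2 * h - k) = omega p (2 * Suc k)"
      using xp xw[of "Suc k"] by (metis mult.commute mult.left_commute mult.right_neutral)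
    then have "(1 - x ^ Suc k) * qbinom x (2 * h) (Suc k) = (1 - omega p (2 * Suc k)) * qbinom x (2 * h) k"
      using qbinom_step_lower[of x "2 * h - k" k] Suc.prems by simp
    also have "\<dots> = (1 - x ^ Suc k) * (- omega p (2 * Suc k) * qbinom x (2 * h) k)"
      using xw[of "Suc k"] by (simp add: algebra_simps)
    finally have "qbinom x (2 * h) (Suc k) = - omega p (2 * Suc k) * qbinom x (2 * h) k"
      by (simp only: mult_left_cancel[OF ne])
    also have "qbinom x (2 * h) k = (-1) ^ k * omega p (k * (k + 1))"
      using Suc.prems by (intro Suc.IH) simp
    also have "- omega p (2 * Suc k) * ((-1) ^ k * omega p (k * (k + 1))) = (-1) ^ Suc k * (omega p (2 * Suc k) * omega p (k * (k + 1)))"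
      by (simp add: mult_ac)
    also have "omega p (2 * Suc k) * omega p (k * (k + 1)) = omega p (Suc k * (Suc k + 1))"
      unfolding omega_add[symmetric] by (rule arg_cong[of _ _ "omega p"]) (simp add: algebra_simps)
    finally show ?case .
  qed
  have "(\<Sum>k\<le>2 * h. (-1) ^ k * qbinom x (2 * h) k) = (\<Sum>k\<le>2 * h. omega p (k * (k + 1)))"
    by (rule sum.cong) (simp_all add: q)
  then have S: "(\<Sum>k\<le>2 * h. omega p (k * (k + 1))) = (\<Prod>j<h. 1 - x ^ (2 * j + 1))"
    by (simp add: gauss_qbinom_sum)
  \<comment> \<open>Modulo \<open>p\<close>, \<open>h + 1\<close> is 1/2 and \<open>h\<close> is
    -1/2, so this is (k + 1/2)^2 = 1/4 + k (k + 1).\<close>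
  have sq: "omega p ((k + (h + 1)) ^ 2) = omega p (h ^ 2) * omega p (k * (k + 1))" for k
  proof -
    have "(k + (h + 1)) ^ 2 = h ^ 2 + k * (k + 1) + p * (k + 1)"
      by (simp add: p_def power2_eq_square algebra_simps)
    then show ?thesis by (simp add: omega_add omega_mult[of p p] omega_self p)
  qed
  \<comment> \<open>The prefactor \<open>omega p (h ^ 2)\<close> is distributed over the product,
    \<open>h ^ 2\<close> being the sum of the first \<open>h\<close> odd numbers
    (\<open>hs\<close>); each factor then becomes w - 1/w.\<close>
  have fac: "omega p (2 * j + 1) * (1 - x ^ (2 * j + 1)) = 2 * \<i> * complex_of_real (sin (2 * pi * real (2 * j + 1) / real p))" for j
  proof -
    let ?w = "omega p (2 * j + 1)"
    have "x ^ (2 * j + 1) = cnj (?w * ?w)"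
      by (simp add: x_def complex_cnj_power[symmetric] omega_mult[symmetric] omega_add[symmetric] del: complex_cnj_power power_Suc)
    then have "?w * (1 - x ^ (2 * j + 1)) = ?w - (?w * cnj ?w) * cnj ?w" by (simp add: algebra_simps)
    also have "?w * cnj ?w = 1" by (simp add: omega_def cis_cnj cis_mult)
    also have "?w - 1 * cnj ?w = 2 * \<i> * complex_of_real (Im ?w)"
      by (simp add: complex_eq_iff)
    finally show ?thesis by (simp add: omega_def)
  qed
  have hs: "omega p (h ^ 2) = (\<Prod>j<h. omega p (2 * j + 1))"
  proof -
    have "(\<Prod>j<i. omega p (2 * j + 1)) = omega p (i ^ 2)" for i
    proof (induction i)
      case (Suc i)
      have "Suc i ^ 2 = i ^ 2 + (2 * i + 1)" by (simp add: power2_eq_square)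
      then show ?case by (simp only: prod.lessThan_Suc Suc.IH omega_add[of p "i ^ 2"])
    qed (simp add: omega_0)
    then show ?thesis by simp
  qed
  have "(\<Sum>k<p. omega p (k ^ 2)) = (\<Sum>k<p. omega p ((k + (h + 1)) ^ 2))"
    by (rule omega_shift_sum[OF p, symmetric])
  also have "\<dots> = omega p (h ^ 2) * (\<Sum>k<p. omega p (k * (k + 1)))"
    by (simp only: sq sum_distrib_left)
  also have "(\<Sum>k<p. omega p (k * (k + 1))) = (\<Sum>k\<le>2 * h. omega p (k * (k + 1)))"
    by (rule sum.cong) (auto simp: p_def)
  also have "omega p (h ^ 2) * (\<Sum>k\<le>2 * h. omega p (k * (k + 1))) = (\<Prod>j<h. omega p (2 * j + 1) * (1 - x ^ (2 * j + 1)))"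
    unfolding S hs by (simp add: prod.distrib)
  also have "\<dots> = (\<Prod>j<h. 2 * \<i> * complex_of_real (sin (2 * pi * real (2 * j + 1) / real p)))"
    by (simp only: fac)
  finally show ?thesis .
qed

text \<open>With \<open>p = 4 * t + 3\<close> there are \<open>2 * t + 1\<close> factors: the sines
  are positive up to \<open>j = t\<close> and negative afterwards. A pair of opposite signs
  contributes (2i)^2 times a negative number, which is positive, and the unpaired factor at
  \<open>j = t\<close> supplies the \<open>\<i>\<close>. The size of \<open>R\<close> is found later
  from the absolute value.\<close>

lemma gauss_sum_3_mod_4:
  assumes "p mod 4 = 3"
  shows "\<exists>R>0. (\<Sum>k<p. omega p (k ^ 2)) = \<i> * complex_of_real R"
proof -
  obtain t where pt: "p = 4 * t + 3" using assms by (metis mult.commute div_mult_mod_eq)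
  define s where "s j = sin (2 * pi * real (2 * j + 1) / real p)" for j
  have pos: "s j > 0" if "j < Suc t" for j
  proof -
    have "pi * real (2 * (2 * j + 1)) < pi * real p"
      using that by (intro mult_strict_left_mono) (simp_all only: of_nat_less_iff pi_gt_zero, simp add: pt)
    then show ?thesis
      unfolding s_def by (intro sin_gt_zero) (simp_all add: pt field_simps add_pos_nonneg)
  qed
  have neg: "s (Suc t + j) < 0" if "j < t" for j
  proof -
    have "pi * real p < pi * real (2 * (2 * (Suc t + j) + 1))"
      using that by (intro mult_strict_left_mono) (simp_all only: of_nat_less_iff pi_gt_zero, simp add: pt)
    moreover have "pi * real (2 * (2 * (Suc t + j) + 1)) < pi * real (2 * p)"
      using that by (intro mult_strict_left_mono) (simp_all only: of_nat_less_iff pi_gt_zero, simp add: pt)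
    ultimately show ?thesis
      unfolding s_def using that by (intro sin_lt_zero) (simp_all add: pt field_simps)
  qed
  have split: "(\<Prod>j<a + b. f j) = (\<Prod>j<a. f j) * (\<Prod>j<b. f (a + j))" for a b and f :: "nat \<Rightarrow> complex"
    by (induction b) (simp_all add: mult.assoc)
  have "p = 2 * (Suc t + t) + 1" by (simp add: pt)
  then have "(\<Sum>k<p. omega p (k ^ 2)) = (\<Prod>j<Suc t + t. 2 * \<i> * complex_of_real (s j))"
    using gauss_sum_product[of "Suc t + t"] by (simp only: s_def)
  also have "\<dots> = (\<Prod>j<Suc t. 2 * \<i> * complex_of_real (s j)) * (\<Prod>j<t. 2 * \<i> * complex_of_real (s (Suc t + j)))"
    by (rule split)
  also have "\<dots> = \<i> * complex_of_real (2 * s t * (\<Prod>j<t. 4 * s j * - s (Suc t + j)))"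
  proof -
    have "(\<Prod>j<t. 2 * \<i> * complex_of_real (s j)) * (\<Prod>j<t. 2 * \<i> * complex_of_real (s (Suc t + j)))
      = (\<Prod>j<t. complex_of_real (4 * s j * - s (Suc t + j)))"
      unfolding prod.distrib[symmetric] by (rule prod.cong) (auto simp: complex_eq_iff)
    then show ?thesis by (simp add: mult_ac)
  qed
  finally have eq: "(\<Sum>k<p. omega p (k ^ 2)) = \<i> * complex_of_real (2 * s t * (\<Prod>j<t. 4 * s j * - s (Suc t + j)))" .
  have "(\<Prod>j<t. 4 * s j * - s (Suc t + j)) > 0"
  proof (rule prod_pos)
    fix j assume "j \<in> {..<t}"
    then show "4 * s j * - s (Suc t + j) > 0" 
      using pos[of j] neg[of j] by (simp add: mult_pos_neg)
  qed
  then have "2 * s t * (\<Prod>j<t. 4 * s j * - s (Suc t + j)) > 0" using pos[of t] by simp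
  then show ?thesis using eq by blast
qed

section \<open>Quadratic characters\<close>

lemma sum_image_card:
  fixes \<phi> :: "'b \<Rightarrow> complex"
  assumes "finite A" "finite B" "\<And>x. x \<in> A \<Longrightarrow> f x \<in> B"
  shows "(\<Sum>x\<in>A. \<phi> (f x)) = (\<Sum>y\<in>B. of_nat (card {x\<in>A. f x = y}) * \<phi> y)"
proof -
  have "(\<Sum>x\<in>A. \<phi> (f x)) = (\<Sum>y\<in>B. \<Sum>x\<in>{x\<in>A. f x = y}. \<phi> (f x))"
    using assms by (intro sum.group[symmetric]) auto
  also have "\<dots> = (\<Sum>y\<in>B. of_nat (card {x\<in>A. f x = y}) * \<phi> y)"
    by (intro sum.cong refl) simp
  finally show ?thesis .
qed

lemma finite_field_fermat:
  fixes x :: "'a::{field,finite}"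
  assumes "x \<noteq> 0"
  shows "x ^ (card (UNIV :: 'a set) - 1) = 1"
proof -
  have "(\<Prod>y\<in>UNIV-{0::'a}. x * y) = \<Prod>(UNIV-{0})"
    by (rule prod.reindex_bij_witness[of _ "\<lambda>y. y / x" "\<lambda>y. x * y"]) (use assms in auto)
  then have "x ^ card (UNIV-{0::'a}) * \<Prod>(UNIV-{0::'a}) = 1 * \<Prod>(UNIV-{0::'a})"
    by (simp add: prod.distrib)
  moreover have "\<Prod>(UNIV-{0::'a}) \<noteq> 0" by simp
  ultimately have "x ^ card (UNIV-{0::'a}) = 1" by (metis mult_right_cancel)
  then show ?thesis by (simp add: card_Diff_subset)
qed

lemma card_power_eq_le:
  fixes c :: "'a::{field,finite}"
  assumes "n > 0"
  shows "card {x::'a. x ^ n = c} \<le> n"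
proof -
  let ?P = "monom 1 n + [:- c:]"
  have d: "degree ?P = n"
    using assms by (subst degree_add_eq_left) (auto simp: degree_monom_eq)
  then have "?P \<noteq> 0" using assms by (metis degree_0 less_irrefl)
  then have "card {x. poly ?P x = 0} \<le> n" using card_poly_roots_bound[of ?P] d by simp
  then show ?thesis by (simp add: poly_monom)
qed

text \<open>The quadratic character of the subfield with \<open>Q\<close> elements, encoded by
  Euler's criterion so that it can be evaluated by computing a power in the larger field.\<close>

definition eta :: "nat \<Rightarrow> 'a::field \<Rightarrow> complex" where
  "eta Q x = (if x = 0 then 0 else if x ^ ((Q - 1) div 2) = 1 then 1 else -1)"

text \<open>Common ground of the prime field and the field with q elements: a subfield with a
  nontrivial additive character, nontriviality being \<open>psi_sum\<close>. The congruence for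
  \<open>Q\<close> makes -1 a nonsquare.\<close>

locale char_field =
  fixes F :: "'a::{field,finite} set" and Q :: nat and \<psi> :: "'a \<Rightarrow> complex"
  assumes one_mem: "1 \<in> F"
    and add_mem: "x \<in> F \<Longrightarrow> y \<in> F \<Longrightarrow> x + y \<in> F"
    and minus_mem: "x \<in> F \<Longrightarrow> - x \<in> F"
    and mult_mem: "x \<in> F \<Longrightarrow> y \<in> F \<Longrightarrow> x * y \<in> F"
    and inverse_mem: "x \<in> F \<Longrightarrow> inverse x \<in> F"
    and card_F: "card F = Q"
    and Q_mod: "Q mod 4 = 3"
    and two_nz: "(2::'a) \<noteq> 0"
    and power_Q: "x \<in> F \<Longrightarrow> x ^ Q = x"
    and psi_add: "x \<in> F \<Longrightarrow> y \<in> F \<Longrightarrow> \<psi> (x + y) = \<psi> x * \<psi> y"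
    and psi_minus: "x \<in> F \<Longrightarrow> \<psi> (- x) = cnj (\<psi> x)"
    and psi_0: "\<psi> 0 = 1"
    and psi_sum: "(\<Sum>x\<in>F. \<psi> x) = 0"
begin

lemma zero_mem: "0 \<in> F"
  using add_mem[OF one_mem minus_mem[OF one_mem]] by simp

lemma diff_mem: "x \<in> F \<Longrightarrow> y \<in> F \<Longrightarrow> x - y \<in> F"
  using add_mem[of x "- y"] minus_mem by simp

lemma divide_mem: "x \<in> F \<Longrightarrow> y \<in> F \<Longrightarrow> x / y \<in> F"
  using mult_mem[of x "inverse y"] inverse_mem by (simp add: divide_inverse)

lemma power_mem: "x \<in> F \<Longrightarrow> x ^ n \<in> F"
  by (induction n) (auto simp: one_mem mult_mem)

lemma two_mem: "2 \<in> F"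
  using add_mem[OF one_mem one_mem] by simp

definition half where "half = (Q - 1) div 2"

lemma Q_half: "Q = 2 * half + 1" and odd_half: "odd half" and half_pos: "half > 0"
proof -
  obtain t where "Q = 4 * t + 3" using Q_mod mult_div_mod_eq[of 4 Q] by metis
  moreover from this have "half = 2 * t + 1" unfolding half_def by simp
  ultimately show "Q = 2 * half + 1" "odd half" "half > 0" by simp_all
qed

lemma power_half: "x \<in> F \<Longrightarrow> x \<noteq> 0 \<Longrightarrow> x ^ half = 1 \<or> x ^ half = -1"
proof -
  assume x: "x \<in> F" "x \<noteq> 0"
  have "x ^ Q = x ^ (2 * half + 1)" by (rule arg_cong[OF Q_half])
  also have "\<dots> = x * (x ^ half) ^ 2" by (simp add: power_mult[symmetric] mult.commute)
  finally have "x * (x ^ half) ^ 2 = x ^ Q" by simp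
  then have "(x ^ half) ^ 2 = 1" using power_Q x by simp
  then show ?thesis by (simp add: power2_eq_1_iff)
qed

lemma one_neq_minus_one: "(1::'a) \<noteq> -1"
  using two_nz by (simp add: eq_neg_iff_add_eq_0)

lemma eta_eq: "eta Q x = (if x = 0 then 0 else if x ^ half = 1 then 1 else -1)"
  unfolding eta_def half_def by simp

lemma eta_0: "eta Q (0::'a) = 0" by (simp add: eta_def)

lemma eta_mult: "x \<in> F \<Longrightarrow> y \<in> F \<Longrightarrow> eta Q (x * y) = eta Q x * eta Q y"
proof (cases "x = 0 \<or> y = 0")
  case False
  assume "x \<in> F" "y \<in> F"
  then have "x ^ half = 1 \<or> x ^ half = -1" "y ^ half = 1 \<or> y ^ half = -1"
    using False power_half by auto
  then show ?thesis using False one_neq_minus_one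
    by (elim disjE) (simp_all add: eta_eq power_mult_distrib one_neq_minus_one[symmetric])
qed (auto simp: eta_eq)

lemma eta_minus: "x \<in> F \<Longrightarrow> eta Q (- x) = - eta Q x"
proof (cases "x = 0")
  case False
  assume "x \<in> F"
  then have "x ^ half = 1 \<or> x ^ half = -1" using False power_half by auto
  then show ?thesis using False odd_half
    by (elim disjE) (simp_all add: eta_eq power_minus_odd one_neq_minus_one[symmetric])
qed (simp add: eta_eq)

lemma eta_cases: "x \<in> F \<Longrightarrow> x \<noteq> 0 \<Longrightarrow> eta Q x = 1 \<or> eta Q x = -1"
  by (auto simp: eta_eq)

lemma eta_square: "x \<in> F \<Longrightarrow> x \<noteq> 0 \<Longrightarrow> eta Q (x ^ 2) = 1"
  using eta_mult[of x x] eta_cases[of x] by (auto simp: power2_eq_square)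

text \<open>Because \<open>half\<close> is odd, a square root is an explicit power, with exponent (Q
  + 1) / 4.\<close>

lemma eta_sqrt:
  assumes "x \<in> F" "eta Q x = 1"
  obtains r where "r \<in> F" "r ^ 2 = x" "r \<noteq> 0"
proof
  have "x \<noteq> 0" "x ^ half = 1" using assms by (auto simp: eta_eq split: if_splits)
  moreover have "2 * ((half + 1) div 2) = half + 1" using odd_half by simp
  ultimately show "(x ^ ((half + 1) div 2)) ^ 2 = x"
    by (simp add: power_mult[symmetric] mult.commute)
  then show "x ^ ((half + 1) div 2) \<noteq> 0" using \<open>x \<noteq> 0\<close> by auto
qed (simp add: assms power_mem)

lemma card_sqrt: 
  assumes "s \<in> F"
  shows "complex_of_nat (card {x\<in>F. x ^ 2 = s}) = 1 + eta Q s"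
proof (cases "s = 0")
  case True
  then have "{x\<in>F. x ^ 2 = s} = {0}" using zero_mem by auto
  then show ?thesis using True by (simp add: eta_0)
next
  case s0: False
  show ?thesis
  proof (cases "eta Q s = 1")
    case True
    then obtain r where r: "r \<in> F" "r ^ 2 = s" "r \<noteq> 0" using eta_sqrt assms by metis
    then have "{x\<in>F. x ^ 2 = s} = {r, - r}" using minus_mem by (auto simp: power2_eq_iff)
    moreover have "r \<noteq> - r"
      using r(3) two_nz by (simp add: eq_neg_iff_add_eq_0 mult_2[symmetric])
    ultimately show ?thesis using True by simp
  next
    case False
    then have e: "{x\<in>F. x ^ 2 = s} = {}" using eta_square s0 by auto
    show ?thesis unfolding e using eta_cases[OF assms s0] False by auto
  qed
qed

lemma sum_squares: "(\<Sum>x\<in>F. \<phi> (x ^ 2)) = (\<Sum>s\<in>F. (1 + eta Q s) * \<phi> s)" for \<phi> :: "'a \<Rightarrow> complex"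
  by (subst sum_image_card[of F F "\<lambda>x. x ^ 2"]) (auto simp: power_mem card_sqrt intro!: sum.cong)

lemma psi_scaled_sum:
  assumes "d \<in> F" "d \<noteq> 0"
  shows "(\<Sum>s\<in>F. \<psi> (d * s)) = 0"
proof -
  have "(\<Sum>s\<in>F. \<psi> (d * s)) = (\<Sum>s\<in>F. \<psi> s)"
    by (rule sum.reindex_bij_witness[of _ "\<lambda>s. s / d" "\<lambda>s. d * s"])
       (use assms in \<open>auto simp: mult_mem divide_mem\<close>)
  then show ?thesis by (simp add: psi_sum)
qed

definition gauss_sum where "gauss_sum = (\<Sum>x\<in>F. \<psi> (x ^ 2))"

lemma gauss_sum_eta: "(\<Sum>s\<in>F. eta Q s * \<psi> s) = gauss_sum"
  unfolding gauss_sum_def by (simp add: sum_squares algebra_simps sum.distrib psi_sum)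

lemma eta_scaled_sum:
  assumes "d \<in> F" "d \<noteq> 0"
  shows "(\<Sum>s\<in>F. eta Q s * \<psi> (d * s)) = eta Q d * gauss_sum"
proof -
  have "(\<Sum>s\<in>F. eta Q d * (eta Q s * \<psi> (d * s))) = (\<Sum>s\<in>F. eta Q s * \<psi> s)"
    by (rule sum.reindex_bij_witness[of _ "\<lambda>s. s / d" "\<lambda>s. d * s"])
       (use assms in \<open>auto simp: mult_mem divide_mem eta_mult\<close>)
  then have "eta Q d * (\<Sum>s\<in>F. eta Q s * \<psi> (d * s)) = gauss_sum"
    by (simp add: sum_distrib_left gauss_sum_eta)
  then show ?thesis using eta_cases[OF assms] by (auto simp: minus_equation_iff)
qed

lemma gauss_sum_twist:
  assumes "d \<in> F" "d \<noteq> 0"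
  shows "(\<Sum>x\<in>F. \<psi> (d * x ^ 2)) = eta Q d * gauss_sum"
  using sum_squares[of "\<lambda>x. \<psi> (d * x)"] psi_scaled_sum[OF assms] eta_scaled_sum[OF assms]
  by (simp add: algebra_simps sum.distrib)

text \<open>After substituting x = d + y, the phase x^2 - y^2 = d^2 + 2 d y is linear in y, so
  summing over y first leaves only d = 0.\<close>

lemma gauss_sum_norm: "gauss_sum * cnj gauss_sum = of_nat Q"
proof -
  have "gauss_sum * cnj gauss_sum = (\<Sum>y\<in>F. \<Sum>x\<in>F. \<psi> (x ^ 2) * \<psi> (- (y ^ 2)))"
    unfolding gauss_sum_def cnj_sum sum_product by (subst sum.swap) (simp add: psi_minus power_mem)
  also have "\<dots> = (\<Sum>y\<in>F. \<Sum>d\<in>F. \<psi> (d ^ 2) * \<psi> (2 * d * y))"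
  proof (rule sum.cong[OF refl])
    fix y assume y: "y \<in> F"
    have "(\<Sum>x\<in>F. \<psi> (x ^ 2) * \<psi> (- (y ^ 2))) = (\<Sum>x\<in>F. \<psi> (x ^ 2 - y ^ 2))"
      by (rule sum.cong) (simp_all add: psi_add[symmetric] power_mem minus_mem y)
    also have "\<dots> = (\<Sum>d\<in>F. \<psi> (d ^ 2 + 2 * d * y))"
      by (rule sum.reindex_bij_witness[of _ "\<lambda>d. d + y" "\<lambda>x. x - y"])
        (simp_all add: y add_mem diff_mem, simp add: power2_eq_square algebra_simps)
    also have "\<dots> = (\<Sum>d\<in>F. \<psi> (d ^ 2) * \<psi> (2 * d * y))"
      by (rule sum.cong) (simp_all add: psi_add power_mem mult_mem two_mem y)
    finally show "(\<Sum>x\<in>F. \<psi> (x ^ 2) * \<psi> (- (y ^ 2))) = (\<Sum>d\<in>F. \<psi> (d ^ 2) * \<psi> (2 * d * y))" .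
  qed
  also have "\<dots> = (\<Sum>d\<in>F. \<psi> (d ^ 2) * (\<Sum>y\<in>F. \<psi> (2 * d * y)))"
    by (subst sum.swap) (simp add: sum_distrib_left)
  also have "\<dots> = (\<Sum>d\<in>F. if d = 0 then of_nat Q else 0)"
    by (rule sum.cong[OF refl])
      (auto simp: psi_scaled_sum mult_mem two_mem two_nz psi_0 card_F)
  also have "\<dots> = of_nat Q"
    by (simp add: zero_mem)
  finally show ?thesis .
qed

end

section \<open>Subfields, traces and additive characters\<close>

text \<open>Pigeonhole: the d-th power maps the \<open>d * n\<close> nonzero elements into the at
  most \<open>n\<close> solutions of \<open>c ^ n = 1\<close>, with fibres of size at most
  \<open>d\<close>; hence every fibre is full.\<close>

lemma card_power_eq:
  fixes c :: "'a::{field,finite}"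
  assumes dn: "d * n = card (UNIV :: 'a set) - 1" and c: "c ^ n = 1"
  shows "card {x::'a. x ^ d = c} = d"
proof (rule ccontr)
  assume ne: "card {x::'a. x ^ d = c} \<noteq> d"
  have "card {0, 1::'a} \<le> card (UNIV :: 'a set)" by (rule card_mono) auto
  then have pos: "d > 0" "n > 0" using dn by (auto intro!: Nat.gr0I)
  define R where "R = {c::'a. c ^ n = 1}"
  have le: "card {x::'a. x ^ d = b} \<le> d" for b by (rule card_power_eq_le[OF pos(1)])
  have "card (UNIV - {0::'a}) = (\<Sum>b\<in>R. card {x\<in>UNIV - {0}. x ^ d = b})"
  proof -
    have "x ^ d \<in> R" if "x \<noteq> 0" for x :: 'a
      using finite_field_fermat[OF that] by (simp add: R_def power_mult[symmetric] dn)
    then have "(\<Sum>b\<in>R. \<Sum>x\<in>{x\<in>UNIV - {0}. x ^ d = b}. 1) = (\<Sum>x\<in>UNIV - {0::'a}. 1::nat)"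
      by (intro sum.group) auto
    then show ?thesis by simp
  qed
  also have "\<dots> \<le> (\<Sum>b\<in>R. card {x::'a. x ^ d = b})"
    by (intro sum_mono card_mono) auto
  also have "\<dots> < (\<Sum>b\<in>R. d)"
  proof (rule sum_strict_mono_ex1)
    show "\<exists>b\<in>R. card {x::'a. x ^ d = b} < d"
      using le[of c] ne c by (intro bexI[of _ c]) (auto simp: R_def)
  qed (use le in auto)
  also have "\<dots> \<le> n * d"
    using card_power_eq_le[OF pos(2), of "1::'a"] by (simp add: R_def)
  finally show False using dn by (simp add: card_Diff_subset mult.commute)
qed

text \<open>Keeps the 1 in \<open>GF 1\<close> and \<open>tr p 1\<close> from being rewritten to
  \<open>Suc 0\<close>.\<close>

declare One_nat_def [simp del]

text \<open>The canonical additive character of the prime field, meaningful only there;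
  \<open>psi p k\<close> below is its lift along the trace.\<close>

definition chi :: "nat \<Rightarrow> 'a::field \<Rightarrow> complex" where
  "chi p x = omega p (fp_val p x)"

definition psi :: "nat \<Rightarrow> nat \<Rightarrow> 'a::field \<Rightarrow> complex" where
  "psi p k x = chi p (tr p 1 k x)"

lemma tr_1_eq: "tr p 1 k x = (\<Sum>i<k. x ^ (p ^ i))"
  by (simp add: tr_def)

text \<open>No other parameter mentions the field, so \<open>ty\<close> is what fixes the
  type.\<close>

locale gf =
  fixes p e :: nat and ty :: "'a::{field,finite} itself"
  assumes prime_p: "prime p" and p_mod: "p mod 4 = 3"
    and card_UNIV: "card (UNIV :: 'a set) = p ^ e"
begin

lemma p_pos: "p > 0" "p > 1" "p \<ge> 3"
proof -
  show "p \<ge> 3" using p_mod mod_less_eq_dividend[of p 4] by simp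
  then show "p > 0" "p > 1" by simp_all
qed

lemma odd_p: "odd p"
  using p_mod by (metis dvd_mod_iff even_numeral odd_numeral)

text \<open>Translation by 1 permutes the field, so the sum of all elements is unchanged by adding 1
  once per element; thus \<open>p ^ e\<close> is 0 in the field.\<close>

lemma of_nat_p: "(of_nat p :: 'a) = 0"
proof -
  have "(\<Sum>x\<in>UNIV. x + 1) = (\<Sum>x\<in>UNIV. x :: 'a)"
    by (rule sum.reindex_bij_witness[of _ "\<lambda>x. x - 1" "\<lambda>x. x + 1"]) auto
  then have "of_nat (card (UNIV :: 'a set)) = (0 :: 'a)" by (simp add: sum.distrib)
  then show ?thesis using card_UNIV by simp
qed

lemma CHAR_p: "CHAR('a) = p"
proof -
  have "CHAR('a) dvd p" using of_nat_p of_nat_eq_0_iff_char_dvd by blast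
  moreover have "CHAR('a) \<noteq> 1" by (simp add: One_nat_def)
  ultimately show ?thesis using prime_p by (meson prime_nat_iff)
qed

lemma two_nz: "(2::'a) \<noteq> 0"
proof
  assume "(2::'a) = 0"
  then have "(of_nat 2 :: 'a) = 0" by simp
  then have "p dvd 2" using CHAR_p of_nat_eq_0_iff_char_dvd by blast
  then show False using p_pos by (auto dest: dvd_imp_le)
qed

lemma frob_add: "(x + y :: 'a) ^ (p ^ k) = x ^ (p ^ k) + y ^ (p ^ k)"
  by (rule freshmans_dream') (simp_all add: CHAR_p prime_p)

lemma frob_sum: "(\<Sum>i\<in>A. f i :: 'a) ^ (p ^ k) = (\<Sum>i\<in>A. f i ^ (p ^ k))"
  by (rule freshmans_dream_sum') (simp_all add: CHAR_p prime_p)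

lemma frob_minus: "(- x :: 'a) ^ (p ^ k) = - (x ^ (p ^ k))"
  by (simp add: odd_p power_minus_odd)

lemma frob_diff: "(x - y :: 'a) ^ (p ^ k) = x ^ (p ^ k) - y ^ (p ^ k)"
  using frob_add[of x "- y" k] frob_minus[of y k] by simp

abbreviation GF :: "nat \<Rightarrow> 'a set" where "GF k \<equiv> subfield_pk p k"

lemma GF_iff: "x \<in> GF k \<longleftrightarrow> x ^ (p ^ k) = x"
  by (simp add: subfield_pk_def)

lemma GF_0: "0 \<in> GF k" and GF_1: "1 \<in> GF k"
  using p_pos by (simp_all add: GF_iff)

lemma GF_add: "x \<in> GF k \<Longrightarrow> y \<in> GF k \<Longrightarrow> x + y \<in> GF k"
  by (simp add: GF_iff frob_add)

lemma GF_minus: "x \<in> GF k \<Longrightarrow> - x \<in> GF k"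
  by (simp add: GF_iff frob_minus)

lemma GF_mult: "x \<in> GF k \<Longrightarrow> y \<in> GF k \<Longrightarrow> x * y \<in> GF k"
  by (simp add: GF_iff power_mult_distrib)

lemma GF_inverse: "x \<in> GF k \<Longrightarrow> inverse x \<in> GF k"
  by (simp add: GF_iff power_inverse)

lemma GF_diff: "x \<in> GF k \<Longrightarrow> y \<in> GF k \<Longrightarrow> x - y \<in> GF k"
  by (simp add: GF_iff frob_diff)

lemma GF_divide: "x \<in> GF k \<Longrightarrow> y \<in> GF k \<Longrightarrow> x / y \<in> GF k"
  by (simp add: GF_iff power_divide)

lemma GF_power: "x \<in> GF k \<Longrightarrow> x ^ n \<in> GF k"
  by (induction n) (auto simp: GF_1 GF_mult)

lemma GF_sum: "(\<And>i. i \<in> A \<Longrightarrow> f i \<in> GF k) \<Longrightarrow> sum f A \<in> GF k"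
  by (induction A rule: infinite_finite_induct) (auto simp: GF_0 GF_add)

lemma GF_mult_exp: "x \<in> GF k \<Longrightarrow> x ^ (p ^ (k * j)) = x"
  by (induction j) (simp_all add: power_add power_mult GF_iff)

lemma GF_1_subset: "x \<in> GF 1 \<Longrightarrow> x \<in> GF k"
  using GF_mult_exp[of x 1 k] by (simp add: GF_iff)

lemma GF_of_nat: "of_nat i \<in> GF k"
  by (induction i) (auto simp: GF_0 GF_1 GF_add)

lemma GF_nonzero: "GF k = insert 0 {x. x ^ (p ^ k - 1) = 1}" if "k > 0"
proof -
  have "p ^ k > 1" using one_less_power[OF p_pos(2) that] .
  then obtain j where j: "p ^ k = Suc j" "j > 0" by (metis gr0_conv_Suc less_nat_zero_code nat_neq_iff One_nat_def)
  show ?thesis unfolding subfield_pk_def j using j(2) by auto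
qed

lemma card_GF:
  assumes "k > 0" "k dvd e"
  shows "card (GF k) = p ^ k"
proof -
  obtain j where j: "e = k * j" using assms(2) by auto
  \<comment> \<open>A geometric series: \<open>p ^ k - 1\<close> divides the order of the
    multiplicative group.\<close>
  have "(p ^ k - 1) * (\<Sum>i<j. (p ^ k) ^ i) = p ^ e - 1"
    unfolding j power_mult using p_pos by (induction j) (simp_all add: algebra_simps diff_mult_distrib)
  then obtain n where n: "(p ^ k - 1) * n = p ^ e - 1" by blast
  have "card {x::'a. x ^ (p ^ k - 1) = 1} = p ^ k - 1"
    by (rule card_power_eq[of _ n]) (simp_all add: card_UNIV n)
  moreover have "p ^ k > 1" using one_less_power[OF p_pos(2) assms(1)] .
  ultimately show ?thesis using GF_nonzero[OF assms(1)] by (simp add: power_0_left)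
qed

lemma inj_of_nat: "inj_on (of_nat :: nat \<Rightarrow> 'a) {..<p}"
proof (rule linorder_inj_onI)
  fix i j assume "i < j" "i \<in> {..<p}" "j \<in> {..<p}"
  show "(of_nat i :: 'a) \<noteq> of_nat j"
  proof
    assume "(of_nat i :: 'a) = of_nat j"
    then have "(of_nat (j - i) :: 'a) = 0" using \<open>i < j\<close> by (simp add: of_nat_diff)
    then have "p dvd j - i" using CHAR_p of_nat_eq_0_iff_char_dvd by blast
    then show False using \<open>i < j\<close> \<open>j \<in> {..<p}\<close> by (auto dest: dvd_imp_le)
  qed
qed auto

lemma GF_1_eq: "GF 1 = of_nat ` {..<p}"
proof (rule card_subset_eq[symmetric])
  show "card (of_nat ` {..<p} :: 'a set) = card (GF 1)"
    using card_GF[of 1] by (simp add: card_image[OF inj_of_nat])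
qed (auto intro: GF_of_nat)

lemma fp_val_of_nat: "i < p \<Longrightarrow> fp_val p (of_nat i :: 'a) = i"
  unfolding fp_val_def by (rule the_equality) (auto dest: inj_onD[OF inj_of_nat])

lemma of_nat_mod_p: "(of_nat (i mod p) :: 'a) = of_nat i"
proof -
  have "(of_nat (p * (i div p) + i mod p) :: 'a) = of_nat (i mod p)"
    by (simp only: of_nat_add of_nat_mult of_nat_p) simp
  then show ?thesis by simp
qed

lemma chi_of_nat: "chi p (of_nat i :: 'a) = omega p i"
proof -
  have "chi p (of_nat i :: 'a) = chi p (of_nat (i mod p) :: 'a)" by (simp add: of_nat_mod_p)
  then show ?thesis by (simp add: chi_def fp_val_of_nat p_pos omega_mod)
qed

lemma GF_1_cases:
  assumes "x \<in> GF 1"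
  obtains i where "i < p" "x = of_nat i"
  using assms GF_1_eq by auto

lemma chi_add: "x \<in> GF 1 \<Longrightarrow> y \<in> GF 1 \<Longrightarrow> chi p (x + y) = chi p x * chi p y"
  by (metis GF_1_cases chi_of_nat of_nat_add omega_add)

lemma chi_0: "chi p (0::'a) = 1"
  using chi_of_nat[of 0] by (simp add: omega_0)

lemma chi_norm: "chi p x * cnj (chi p x) = 1"
  by (simp add: chi_def omega_def cis_cnj cis_mult)

lemma chi_minus: "x \<in> GF 1 \<Longrightarrow> chi p (- x) = cnj (chi p x)"
proof -
  assume "x \<in> GF 1"
  then have "chi p x * chi p (- x) = chi p x * cnj (chi p x)"
    using chi_add[of x "- x"] GF_minus by (simp add: chi_0 chi_norm)
  moreover have "chi p x \<noteq> 0" by (simp add: chi_def omega_nonzero)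
  ultimately show ?thesis by simp
qed

lemma chi_eq_1_iff: "x \<in> GF 1 \<Longrightarrow> chi p x = 1 \<longleftrightarrow> x = 0"
proof -
  assume "x \<in> GF 1"
  then obtain i where i: "i < p" "x = of_nat i" by (rule GF_1_cases)
  show ?thesis unfolding i(2) chi_of_nat omega_eq_1_iff[OF p_pos(1)]
    using CHAR_p of_nat_eq_0_iff_char_dvd by blast
qed

lemma tr_add: "tr p 1 k (x + y :: 'a) = tr p 1 k x + tr p 1 k y"
  by (simp add: tr_1_eq frob_add sum.distrib)

lemma tr_minus: "tr p 1 k (- x :: 'a) = - tr p 1 k x"
  by (simp add: tr_1_eq frob_minus sum_negf)

lemma tr_0: "tr p 1 k (0::'a) = 0"
  using p_pos by (simp add: tr_1_eq power_0_left)

lemma tr_scale: "c \<in> GF 1 \<Longrightarrow> tr p 1 k (c * x :: 'a) = c * tr p 1 k x"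
  using GF_1_subset[of c] by (simp add: tr_1_eq power_mult_distrib sum_distrib_left GF_iff)

lemma tr_frob: "x \<in> GF k \<Longrightarrow> tr p 1 k (x ^ p) = tr p 1 k x"
proof -
  assume x: "x \<in> GF k"
  \<comment> \<open>Both sides of the claim, enlarged by \<open>x\<close>, are the same sum of
    \<open>k + 1\<close> conjugates; no cyclic reindexing arises.\<close>
  have "x + tr p 1 k (x ^ p) = (\<Sum>i<Suc k. x ^ (p ^ i))"
    by (subst sum.lessThan_Suc_shift) (simp add: tr_1_eq power_mult[symmetric])
  also have "\<dots> = tr p 1 k x + x" using x by (simp add: tr_1_eq GF_iff)
  finally show ?thesis by simp
qed

lemma tr_mem: "x \<in> GF k \<Longrightarrow> tr p 1 k x \<in> GF 1"
proof -
  assume "x \<in> GF k"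
  then have "tr p 1 k x = tr p 1 k (x ^ p)" by (simp only: tr_frob)
  also have "\<dots> = (\<Sum>i<k. (x ^ (p ^ i)) ^ (p ^ 1))"
    by (simp add: tr_1_eq power_mult[symmetric] mult.commute)
  also have "\<dots> = (tr p 1 k x) ^ (p ^ 1)" by (simp only: frob_sum tr_1_eq)
  finally show ?thesis by (simp only: GF_iff)
qed

text \<open>The trace is a polynomial of degree at most \<open>p ^ (k - 1)\<close>, nonzero because
  its linear coefficient is 1, so it has too few roots to vanish on all \<open>p ^ k\<close>
  elements.\<close>

lemma tr_nontrivial:
  assumes "k > 0" "k dvd e"
  obtains x where "x \<in> GF k" "tr p 1 k x \<noteq> 0"
proof -
  define P :: "'a poly" where "P = (\<Sum>i<k. monom 1 (p ^ i))"
  have ev: "poly P x = tr p 1 k x" for x by (simp add: P_def poly_sum poly_monom tr_1_eq)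
  have co: "coeff P 1 = 1"
  proof -
    have "coeff P 1 = (\<Sum>i<k. if i = 0 then 1 else 0)"
      unfolding P_def coeff_sum coeff_monom
      using one_less_power[OF p_pos(2)] by (intro sum.cong) (force simp: gr0_conv_Suc)+
    then show ?thesis using assms by simp
  qed
  then have nz: "P \<noteq> 0" by auto
  have deg: "degree P \<le> p ^ (k - 1)"
    unfolding P_def
  proof (rule degree_sum_le)
    fix i assume "i \<in> {..<k}"
    then have "p ^ i \<le> p ^ (k - 1)" using p_pos by (intro power_increasing) auto
    then show "degree (monom (1::'a) (p ^ i)) \<le> p ^ (k - 1)" by (simp add: degree_monom_eq)
  qed simp
  have "card {x. poly P x = 0} \<le> p ^ (k - 1)"
    using card_poly_roots_bound[OF nz] deg by simp
  also have "\<dots> < card (GF k)" using card_GF[OF assms] assms p_pos by simp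
  finally have "\<not> GF k \<subseteq> {x. poly P x = 0}"
    by (meson card_mono finite not_less)
  then show ?thesis using that ev by auto
qed

lemma psi_char_field:
  assumes "k > 0" "k dvd e" "odd k"
  shows "char_field (GF k) (p ^ k) (psi p k)"
proof
  show "(p ^ k) mod 4 = 3"
  proof -
    obtain j where j: "k = 2 * j + 1" using assms(3) by (elim oddE)
    have "p ^ k mod 4 = (3 ^ k) mod 4" by (metis p_mod power_mod)
    also have "(3::nat) ^ k = 3 * 9 ^ j" by (simp add: j power_mult power_add)
    also have "3 * (9::nat) ^ j mod 4 = 3 * (9 ^ j mod 4) mod 4" by (rule mod_mult_right_eq[symmetric])
    also have "(9::nat) ^ j mod 4 = (9 mod 4) ^ j mod 4" by (rule power_mod[symmetric])
    finally show ?thesis by simp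
  qed
  show "psi p k (x + y) = psi p k x * psi p k y" if "x \<in> GF k" "y \<in> GF k" for x y
    using that by (simp add: psi_def tr_add chi_add tr_mem)
  show "psi p k (- x) = cnj (psi p k x)" if "x \<in> GF k" for x
    using that by (simp add: psi_def tr_minus chi_minus tr_mem)
  then show "psi p k (0::'a) = 1" by (simp add: psi_def tr_0 chi_0)
  obtain x0 where x0: "x0 \<in> GF k" "tr p 1 k x0 \<noteq> 0" using tr_nontrivial assms by blast
  have "(\<Sum>x\<in>GF k. psi p k x) = (\<Sum>x\<in>GF k. psi p k (x + x0))"
    by (rule sum.reindex_bij_witness[of _ "\<lambda>x. x + x0" "\<lambda>x. x - x0"]) (auto simp: x0 GF_add GF_diff)
  also have "\<dots> = psi p k x0 * (\<Sum>x\<in>GF k. psi p k x)"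
    by (simp add: psi_def tr_add chi_add tr_mem x0 sum_distrib_left mult.commute)
  finally have "(1 - psi p k x0) * (\<Sum>x\<in>GF k. psi p k x) = 0" by (simp add: algebra_simps)
  moreover have "psi p k x0 \<noteq> 1" using x0 by (simp add: psi_def chi_eq_1_iff tr_mem)
  ultimately show "(\<Sum>x\<in>GF k. psi p k x) = 0" by simp
qed (use assms two_nz in \<open>simp_all add: GF_1 GF_add GF_minus GF_mult GF_inverse card_GF\<close>, simp add: GF_iff)

lemma psi_1: "psi p 1 x = chi p x"
  by (simp add: psi_def tr_1_eq)

end

section \<open>Gauss sums over extension fields\<close>

context gf
begin

text \<open>Subspaces over the prime field on which the trace form, sending (x, y) to Tr(x y), is
  nondegenerate.\<close>

definition nondeg :: "nat \<Rightarrow> 'a set \<Rightarrow> bool" where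
  "nondeg k W \<longleftrightarrow> W \<subseteq> GF k \<and> 0 \<in> W \<and> (\<forall>x\<in>W. \<forall>y\<in>W. x + y \<in> W) \<and>
     (\<forall>c\<in>GF 1. \<forall>x\<in>W. c * x \<in> W) \<and>
     (\<forall>x\<in>W. (\<forall>y\<in>W. tr p 1 k (x * y) = 0) \<longrightarrow> x = 0)"

text \<open>Polarisation: if Tr(u^2) vanished on all of \<open>W\<close>, so would 2 Tr(x y),
  although 2 is invertible.\<close>

lemma nondeg_anisotropic:
  assumes "nondeg k W" "x \<in> W" "x \<noteq> 0"
  obtains u where "u \<in> W" "tr p 1 k (u ^ 2) \<noteq> 0"
proof (rule ccontr)
  assume "\<not> thesis"
  with that have iso: "tr p 1 k (u ^ 2) = 0" if "u \<in> W" for u using that by blast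
  obtain y where y: "y \<in> W" "tr p 1 k (x * y) \<noteq> 0"
    using assms unfolding nondeg_def by blast
  have "x + y \<in> W" using assms y unfolding nondeg_def by blast
  then have "0 = tr p 1 k ((x + y) ^ 2)" by (simp add: iso)
  also have "(x + y) ^ 2 = x ^ 2 + (x * y + x * y) + y ^ 2"
    by (simp add: power2_eq_square algebra_simps)
  also have "tr p 1 k \<dots> = 2 * tr p 1 k (x * y)"
    by (simp only: tr_add iso[OF assms(2)] iso[OF y(1)]) simp
  finally show False using y two_nz by simp
qed

text \<open>Orthogonal splitting into the line through \<open>v\<close> and its complement. The
  coordinate on the line is Tr(x v) / d with d = Tr(v^2), the mixed term of the square has trace 0,
  and the line contributes the prime Gauss sum twisted by d. Cardinalities stand in for
  dimensions.\<close>

lemma nondeg_split: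
  assumes k: "k > 0" "k dvd e" and W: "nondeg k W" and v: "v \<in> W" "tr p 1 k (v ^ 2) \<noteq> 0"
  defines "W' \<equiv> {x\<in>W. tr p 1 k (x * v) = 0}"
  shows "nondeg k W'" "card W = p * card W'"
    "(\<Sum>x\<in>W. psi p k (x ^ 2)) =
       eta p (tr p 1 k (v ^ 2)) * (\<Sum>c\<in>GF 1. chi p (c ^ 2)) * (\<Sum>x\<in>W'. psi p k (x ^ 2))"
proof -
  let ?B = "\<lambda>x y :: 'a. tr p 1 k (x * y)"
  define d where "d = tr p 1 k (v ^ 2)"
  have sub: "W \<subseteq> GF k" and add: "x \<in> W \<Longrightarrow> y \<in> W \<Longrightarrow> x + y \<in> W"
    and scale: "c \<in> GF 1 \<Longrightarrow> x \<in> W \<Longrightarrow> c * x \<in> W"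
    and nd: "x \<in> W \<Longrightarrow> (\<And>y. y \<in> W \<Longrightarrow> ?B x y = 0) \<Longrightarrow> x = 0" for x y c
    using W unfolding nondeg_def by blast+
  have m1: "(- 1) \<in> GF 1" using GF_minus GF_1 by blast
  have vk: "v \<in> GF k" using v sub by auto
  have d: "d \<in> GF 1" "d \<noteq> 0" using vk v by (simp_all add: d_def tr_mem GF_power)
  have B1: "?B (c * x) y = c * ?B x y" if "c \<in> GF 1" for c x y
    using tr_scale[OF that, of k "x * y"] by (simp add: mult.assoc)
  have B2: "?B (x + y) z = ?B x z + ?B y z" for x y z
    by (simp add: tr_add distrib_right)
  have Bv: "?B v v = d" by (simp add: d_def power2_eq_square)
  have "tr p 1 k (x * v) \<in> GF 1" if "x \<in> W" for x
    using that sub vk by (intro tr_mem GF_mult) auto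
  then have coeff: "?B x v / d \<in> GF 1" if "x \<in> W" for x
    using that d by (simp add: GF_divide)
  have proj: "x - ?B x v / d * v \<in> W'" if x: "x \<in> W" for x
  proof -
    have c: "- (?B x v / d) \<in> GF 1" using coeff[OF x] by (rule GF_minus)
    have "x + (- (?B x v / d)) * v \<in> W" using x v c by (intro add scale) auto
    moreover have "?B (x + (- (?B x v / d)) * v) v = 0"
      unfolding B2 B1[OF c] Bv using d by simp
    ultimately show ?thesis by (simp add: W'_def)
  qed
  have W'W: "x \<in> W" "?B x v = 0" if "x \<in> W'" for x using that by (auto simp: W'_def)
  have bij: "bij_betw (\<lambda>(c, w). c * v + w) (GF 1 \<times> W') W"
  proof (rule bij_betw_byWitness[where f' = "\<lambda>x. (?B x v / d, x - ?B x v / d * v)"])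
    show "\<forall>a\<in>GF 1 \<times> W'. (\<lambda>x. (?B x v / d, x - ?B x v / d * v)) ((\<lambda>(c, w). c * v + w) a) = a"
      using d W'W by (auto simp: B2 B1 Bv)
    show "(\<lambda>(c, w). c * v + w) ` (GF 1 \<times> W') \<subseteq> W" using W'W v by (auto intro!: add scale)
    show "(\<lambda>x. (?B x v / d, x - ?B x v / d * v)) ` W \<subseteq> GF 1 \<times> W'" using coeff proj by auto
  qed auto
  show "card W = p * card W'"
    using bij_betw_same_card[OF bij] card_GF[of 1] by (simp add: card_cartesian_product)
  show "nondeg k W'"
    unfolding nondeg_def
  proof (intro conjI ballI impI)
    show "W' \<subseteq> GF k" using sub by (auto simp: W'_def)
    show "0 \<in> W'" using W by (auto simp: W'_def nondeg_def tr_0)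
    show "x + y \<in> W'" if "x \<in> W'" "y \<in> W'" for x y
      using that add by (auto simp: W'_def B2)
    show "c * x \<in> W'" if "c \<in> GF 1" "x \<in> W'" for c x
      using that scale by (auto simp: W'_def B1)
    show "x = 0" if x: "x \<in> W'" and z: "\<forall>y\<in>W'. ?B x y = 0" for x
    proof (rule nd)
      show "x \<in> W" using x W'W by auto
      fix y assume "y \<in> W"
      then obtain c w where cw: "c \<in> GF 1" "w \<in> W'" "y = c * v + w"
        using bij unfolding bij_betw_def by (auto simp: image_def)
      have "?B x y = c * ?B x v + ?B x w"
        using B1[OF cw(1), of v x] by (simp add: cw distrib_left tr_add mult.commute)
      then show "?B x y = 0" using x z cw W'W by simp
    qed
  qed
  interpret F1: char_field "GF 1" "p ^ 1" "psi p 1"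
    by (rule psi_char_field) auto
  have "(\<Sum>x\<in>W. psi p k (x ^ 2)) = (\<Sum>(c, w)\<in>GF 1 \<times> W'. psi p k ((c * v + w) ^ 2))"
    by (subst sum.reindex_bij_betw[OF bij, symmetric]) (simp add: case_prod_beta)
  also have "\<dots> = (\<Sum>(c, w)\<in>GF 1 \<times> W'. chi p (d * c ^ 2) * psi p k (w ^ 2))"
  proof (rule sum.cong[OF refl], clarify)
    fix c w assume c: "c \<in> GF 1" and w: "w \<in> W'"
    have wk: "w \<in> GF k" using w W'W sub by blast
    have cc: "c * c \<in> GF 1" "c + c \<in> GF 1" using c by (blast intro: GF_mult GF_add)+
    have "(c * v + w) ^ 2 = (c * c) * (v * v) + (c + c) * (w * v) + w ^ 2"
      by (simp add: power2_eq_square algebra_simps)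
    then have "tr p 1 k ((c * v + w) ^ 2) = d * c ^ 2 + tr p 1 k (w ^ 2)"
      using W'W(2)[OF w] Bv by (simp only: tr_add tr_scale[OF cc(1)] tr_scale[OF cc(2)]) (simp add: power2_eq_square)
    then show "psi p k ((c * v + w) ^ 2) = chi p (d * c ^ 2) * psi p k (w ^ 2)"
      unfolding psi_def using c d wk by (simp add: chi_add GF_mult GF_power tr_mem)
  qed
  also have "\<dots> = (\<Sum>c\<in>GF 1. chi p (d * c ^ 2)) * (\<Sum>w\<in>W'. psi p k (w ^ 2))"
    by (simp add: sum_product sum.cartesian_product)
  also have "(\<Sum>c\<in>GF 1. chi p (d * c ^ 2)) = eta p d * (\<Sum>c\<in>GF 1. chi p (c ^ 2))"
    using F1.gauss_sum_twist[OF d] by (simp add: F1.gauss_sum_def psi_1)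
  finally show "(\<Sum>x\<in>W. psi p k (x ^ 2)) =
       eta p (tr p 1 k (v ^ 2)) * (\<Sum>c\<in>GF 1. chi p (c ^ 2)) * (\<Sum>x\<in>W'. psi p k (x ^ 2))"
    by (simp add: d_def)
qed

lemma nondeg_GF:
  assumes "k > 0" "k dvd e"
  shows "nondeg k (GF k)"
  unfolding nondeg_def
proof (intro conjI ballI impI)
  show "c * x \<in> GF k" if "c \<in> GF 1" "x \<in> GF k" for c x
    using that GF_1_subset GF_mult by blast
  show "x = 0" if x: "x \<in> GF k" and z: "\<forall>y\<in>GF k. tr p 1 k (x * y) = 0" for x
  proof (rule ccontr)
    assume "x \<noteq> 0"
    obtain t where t: "t \<in> GF k" "tr p 1 k t \<noteq> 0" using tr_nontrivial[OF assms] .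
    then show False using z[rule_format, of "t / x"] x \<open>x \<noteq> 0\<close> by (simp add: GF_divide)
  qed
qed (auto simp: GF_0 GF_add)

text \<open>The state of an orthogonalisation after \<open>r\<close> steps: the vectors found, the
  complement \<open>W\<close> of codimension \<open>r\<close> (expressed by its cardinality), and
  the Gauss sum with \<open>r\<close> factors split off.\<close>

definition orth_system :: "nat \<Rightarrow> nat \<Rightarrow> (nat \<Rightarrow> 'a) \<Rightarrow> 'a set \<Rightarrow> bool" where
  "orth_system k r v W \<longleftrightarrow> nondeg k W \<and> card W * p ^ r = p ^ k \<and>
    (\<forall>i<r. v i \<in> GF k \<and> tr p 1 k (v i * v i) \<noteq> 0 \<and> (\<forall>w\<in>W. tr p 1 k (w * v i) = 0)) \<and>
    (\<forall>i<r. \<forall>j<r. i \<noteq> j \<longrightarrow> tr p 1 k (v i * v j) = 0) \<and>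
    (\<Sum>x\<in>GF k. psi p k (x ^ 2)) = (\<Prod>i<r. eta p (tr p 1 k (v i * v i))) *
        (\<Sum>c\<in>GF 1. chi p (c ^ 2)) ^ r * (\<Sum>x\<in>W. psi p k (x ^ 2))"

lemma orth_system_exists:
  assumes k: "k > 0" "k dvd e" and "r \<le> k"
  shows "\<exists>v W. orth_system k r v W"
  using \<open>r \<le> k\<close>
proof (induction r)
  case 0
  have "orth_system k 0 (\<lambda>_. 0) (GF k)"
    by (simp add: orth_system_def nondeg_GF[OF k] card_GF[OF k])
  then show ?case by blast
next
  case (Suc r)
  then obtain v W where *: "orth_system k r v W" by auto
  then have W: "nondeg k W" and cW: "card W * p ^ r = p ^ k"
    and v: "\<And>i. i < r \<Longrightarrow> v i \<in> GF k" "\<And>i. i < r \<Longrightarrow> tr p 1 k (v i * v i) \<noteq> 0"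
      "\<And>i w. i < r \<Longrightarrow> w \<in> W \<Longrightarrow> tr p 1 k (w * v i) = 0"
      "\<And>i j. i < r \<Longrightarrow> j < r \<Longrightarrow> i \<noteq> j \<Longrightarrow> tr p 1 k (v i * v j) = 0"
    unfolding orth_system_def by blast+
  have S: "(\<Sum>x\<in>GF k. psi p k (x ^ 2)) = (\<Prod>i<r. eta p (tr p 1 k (v i * v i))) *
        (\<Sum>c\<in>GF 1. chi p (c ^ 2)) ^ r * (\<Sum>x\<in>W. psi p k (x ^ 2))"
    using * unfolding orth_system_def by (elim conjE)
  \<comment> \<open>For \<open>r < k\<close> the complement is still nonzero, hence contains a
    further non-isotropic vector.\<close>
  have "card W \<noteq> 1"
  proof
    assume "card W = 1"
    then have "p ^ r = p ^ k" using cW by simp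
    then show False using Suc.prems p_pos by simp
  qed
  moreover have "0 \<in> W" using W by (simp add: nondeg_def)
  ultimately have "W \<noteq> {0}" "W \<noteq> {}" by auto
  then obtain x where "x \<in> W" "x \<noteq> 0" by blast
  then obtain u where u: "u \<in> W" "tr p 1 k (u ^ 2) \<noteq> 0"
    using nondeg_anisotropic W by blast
  define W' where "W' = {x\<in>W. tr p 1 k (x * u) = 0}"
  note sp = nondeg_split[OF k W u, folded W'_def]
  define v' where "v' = v(r := u)"
  have uk: "u \<in> GF k" using u W by (auto simp: nondeg_def)
  have "card W' * p ^ Suc r = p ^ k" using cW sp(2) by (simp add: mult_ac)
  moreover have "v' i \<in> GF k \<and> tr p 1 k (v' i * v' i) \<noteq> 0 \<and> (\<forall>w\<in>W'. tr p 1 k (w * v' i) = 0)" if "i < Suc r" for i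
    using that v(1-3) uk u by (cases "i = r") (auto simp: v'_def W'_def power2_eq_square)
  moreover have "tr p 1 k (v' i * v' j) = 0" if "i < Suc r" "j < Suc r" "i \<noteq> j" for i j
    using that v(3)[OF _ u(1)] v(4) by (cases "i = r"; cases "j = r") (auto simp: v'_def mult.commute)
  moreover have "(\<Sum>x\<in>GF k. psi p k (x ^ 2)) = (\<Prod>i<Suc r. eta p (tr p 1 k (v' i * v' i))) *
        (\<Sum>c\<in>GF 1. chi p (c ^ 2)) ^ Suc r * (\<Sum>x\<in>W'. psi p k (x ^ 2))"
  proof -
    have "(\<Prod>i<r. eta p (tr p 1 k (v' i * v' i))) = (\<Prod>i<r. eta p (tr p 1 k (v i * v i)))"
      by (rule prod.cong) (auto simp: v'_def)
    then show ?thesis unfolding S sp(3) by (simp add: v'_def power2_eq_square mult_ac)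
  qed
  ultimately have "orth_system k (Suc r) v' W'" using sp(1) unfolding orth_system_def by blast
  then show ?case by blast
qed

text \<open>The discriminant of the trace form is the square of \<open>det (v\<^sub>i ^ (p ^ j))\<close>. Frobenius permutes
  the rows of this matrix cyclically; since the cycle has odd length, it fixes the determinant,
  which therefore lies in the prime field.\<close>

lemma discriminant_square:
  assumes k: "k > 0" "odd k"
    and v: "\<And>i. i < k \<Longrightarrow> v i \<in> GF k" "\<And>i. i < k \<Longrightarrow> tr p 1 k (v i * v i) \<noteq> 0"
      "\<And>i j. i < k \<Longrightarrow> j < k \<Longrightarrow> i \<noteq> j \<Longrightarrow> tr p 1 k (v i * v j) = 0"
  obtains D where "D \<in> GF 1" "D \<noteq> 0" "(\<Prod>i<k. tr p 1 k (v i * v i)) = D ^ 2"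
proof -
  define M where "M = mat k k (\<lambda>(j, i). v i ^ (p ^ j))"
  have M: "M \<in> carrier_mat k k" by (simp add: M_def)
  define D where "D = det M"
  define E where "E = mat k k (\<lambda>(i, j). if i = j then tr p 1 k (v i * v i) else 0)"
  \<comment> \<open>The product is the Gram matrix of the trace form, diagonal by
    orthogonality.\<close>
  have "transpose_mat M * M = E"
  proof (rule eq_matI)
    fix i j assume ij: "i < dim_row E" "j < dim_col E"
    then have "(transpose_mat M * M) $$ (i, j) = (\<Sum>l<k. v i ^ (p ^ l) * v j ^ (p ^ l))"
      by (simp add: E_def M_def scalar_prod_def lessThan_atLeast0)
    also have "\<dots> = tr p 1 k (v i * v j)" by (simp add: tr_1_eq power_mult_distrib)
    also have "\<dots> = E $$ (i, j)" using ij v(3) by (simp add: E_def)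
    finally show "(transpose_mat M * M) $$ (i, j) = E $$ (i, j)" .
  qed (simp_all add: M_def E_def)
  then have "det E = D ^ 2"
    using det_mult[of "transpose_mat M" k M] M det_transpose[OF M] by (simp add: D_def power2_eq_square)
  moreover have "det E = (\<Prod>i<k. tr p 1 k (v i * v i))"
  proof -
    have "det E = prod_list (diag_mat E)"
      by (rule det_upper_triangular) (auto simp: E_def)
    also have "diag_mat E = map (\<lambda>i. tr p 1 k (v i * v i)) [0..<k]"
      by (auto simp: diag_mat_def E_def)
    also have "prod_list \<dots> = (\<Prod>i<k. tr p 1 k (v i * v i))"
      by (simp add: prod.distinct_set_conv_list[symmetric] lessThan_atLeast0)
    finally show ?thesis .
  qed
  ultimately have D2: "(\<Prod>i<k. tr p 1 k (v i * v i)) = D ^ 2" by simp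
  have D0: "D \<noteq> 0"
  proof
    assume "D = 0"
    then have "(\<Prod>i<k. tr p 1 k (v i * v i)) = 0" using D2 by simp
    then show False using v(2) by auto
  qed
  define \<pi> where "\<pi> j = (if j < k then if Suc j = k then 0 else Suc j else j)" for j
  have perm: "\<pi> permutes {0..<k}"
  proof (rule bij_imp_permutes)
    have "inj_on \<pi> {0..<k}" by (rule inj_onI) (auto simp: \<pi>_def split: if_splits)
    moreover have "\<pi> ` {0..<k} \<subseteq> {0..<k}" by (auto simp: \<pi>_def)
    ultimately show "bij_betw \<pi> {0..<k} {0..<k}"
      by (simp add: bij_betw_def card_image card_subset_eq)
  qed (auto simp: \<pi>_def)
  interpret frob: comm_ring_hom "\<lambda>x::'a. x ^ p"
    using frob_add[of _ _ 1] p_pos by unfold_locales (auto simp: power_mult_distrib)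
  have "map_mat (\<lambda>x. x ^ p) M = mat k k (\<lambda>(i, j). M $$ (\<pi> i, j))"
  proof (rule eq_matI)
    fix i j assume "i < dim_row (mat k k (\<lambda>(i, j). M $$ (\<pi> i, j)))" "j < dim_col (mat k k (\<lambda>(i, j). M $$ (\<pi> i, j)))"
    then have ij: "i < k" "j < k" by auto
    have "(v j ^ (p ^ i)) ^ p = v j ^ (p ^ Suc i)" by (simp add: power_mult[symmetric] mult.commute)
    also have "\<dots> = v j ^ (p ^ \<pi> i)" using v(1)[OF ij(2)] ij by (auto simp: \<pi>_def GF_iff simp del: power_Suc)
    finally show "map_mat (\<lambda>x. x ^ p) M $$ (i, j) = mat k k (\<lambda>(i, j). M $$ (\<pi> i, j)) $$ (i, j)"
      using ij by (auto simp: M_def \<pi>_def)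
  qed (simp_all add: M_def)
  then have "D ^ p = of_int (sign \<pi>) * D"
    using det_permute_rows[OF M perm] frob.hom_det[of M] by (simp add: D_def)
  then have Dp: "D ^ p = D \<or> D ^ p = - D" by (auto simp: sign_def)
  have "D \<in> GF k"
    unfolding D_def det_def'[OF M]
  proof (intro GF_sum GF_mult)
    fix q assume "q \<in> {q. q permutes {0..<k}}"
    then have q: "i < k \<Longrightarrow> q i < k" for i by (auto dest: permutes_in_image)
    have "(\<Prod>i\<in>A. M $$ (i, q i)) \<in> GF k" if "finite A" "A \<subseteq> {0..<k}" for A
      using that
    proof (induction A)
      case (insert i A)
      then have "M $$ (i, q i) \<in> GF k" using q[of i] v(1)[of "q i"] by (simp add: M_def GF_power)
      then show ?case using insert by (simp add: GF_mult)
    qed (simp add: GF_1)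
    then show "(\<Prod>i = 0..<k. M $$ (i, q i)) \<in> GF k" by simp
  qed (auto simp: sign_def GF_1 GF_minus)
  have "D \<in> GF 1"
  proof (cases "D ^ p = D")
    case True
    then show ?thesis by (simp add: GF_iff)
  next
    case False
    then have neg: "D ^ p = - D" using Dp by simp
    \<comment> \<open>The minus sign is excluded by iterating Frobenius \<open>k\<close> times: for
      odd \<open>k\<close> this would give \<open>- D\<close>, but \<open>D\<close> lies in
      \<open>GF k\<close> and is fixed.\<close>
    have "D ^ (p ^ i) = (-1) ^ i * D" for i
    proof (induction i)
      case (Suc i)
      have "D ^ (p ^ Suc i) = (D ^ (p ^ i)) ^ p" by (simp add: power_mult[symmetric] mult.commute)
      also have "\<dots> = ((-1) ^ i) ^ p * D ^ p" by (simp add: Suc.IH power_mult_distrib)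
      also have "((-1) ^ i) ^ p = ((-1::'a) ^ p) ^ i" by (simp add: power_mult[symmetric] mult.commute)
      also have "\<dots> = (-1) ^ i" by (simp add: odd_p)
      finally show ?case by (simp add: neg)
    qed simp
    then have "D = - D" using \<open>D \<in> GF k\<close> k by (simp add: GF_iff)
    then show ?thesis using D0 two_nz by (simp add: eq_neg_iff_add_eq_0 mult_2[symmetric])
  qed
  then show ?thesis using that D0 D2 by blast
qed

text \<open>The direction comes from \<open>gauss_sum_3_mod_4\<close>, the length from
  \<open>gauss_sum_norm\<close>.\<close>

lemma gauss_sum_GF_1: "(\<Sum>c\<in>GF 1. chi p (c ^ 2)) = \<i> * complex_of_real (sqrt (real p))"
proof -
  interpret F1: char_field "GF 1" "p ^ 1" "psi p 1"
    by (rule psi_char_field) auto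
  have "(\<Sum>c\<in>GF 1. chi p (c ^ 2)) = (\<Sum>i<p. chi p ((of_nat i :: 'a) ^ 2))"
    unfolding GF_1_eq by (subst sum.reindex[OF inj_of_nat]) simp
  also have "\<dots> = (\<Sum>i<p. omega p (i ^ 2))"
    by (simp only: of_nat_power[symmetric] chi_of_nat)
  finally obtain R where R: "R > 0" "(\<Sum>c\<in>GF 1. chi p (c ^ 2)) = \<i> * complex_of_real R"
    using gauss_sum_3_mod_4[OF p_mod] by auto
  have "complex_of_real (R * R) = (\<i> * complex_of_real R) * cnj (\<i> * complex_of_real R)"
    by (simp add: complex_eq_iff)
  also have "\<dots> = of_nat p"
    using F1.gauss_sum_norm by (simp only: F1.gauss_sum_def psi_1 R(2) power_one_right)
  finally have "complex_of_real (R * R) = of_nat p" .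
  then have "R * R = real p" by (metis of_real_eq_iff of_real_of_nat_eq)
  then have "R = sqrt (real p)" using R(1) by (simp add: real_sqrt_unique power2_eq_square)
  then show ?thesis using R by simp
qed

lemma gauss_sum_GF:
  assumes k: "k > 0" "k dvd e" "odd k"
  shows "(\<Sum>x\<in>GF k. psi p k (x ^ 2)) = (\<i> * complex_of_real (sqrt (real p))) ^ k"
proof -
  interpret F1: char_field "GF 1" "p ^ 1" "psi p 1"
    by (rule psi_char_field) auto
  obtain v W where *: "orth_system k k v W"
    using orth_system_exists[OF k(1,2) order_refl] by blast
  then have W: "nondeg k W" and cW: "card W * p ^ k = p ^ k"
    and v: "\<And>i. i < k \<Longrightarrow> v i \<in> GF k" "\<And>i. i < k \<Longrightarrow> tr p 1 k (v i * v i) \<noteq> 0"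
      "\<And>i j. i < k \<Longrightarrow> j < k \<Longrightarrow> i \<noteq> j \<Longrightarrow> tr p 1 k (v i * v j) = 0"
    unfolding orth_system_def by blast+
  have S: "(\<Sum>x\<in>GF k. psi p k (x ^ 2)) = (\<Prod>i<k. eta p (tr p 1 k (v i * v i))) *
        (\<Sum>c\<in>GF 1. chi p (c ^ 2)) ^ k * (\<Sum>x\<in>W. psi p k (x ^ 2))"
    using * unfolding orth_system_def by (elim conjE)
  \<comment> \<open>After \<open>k\<close> steps the space is exhausted and the remaining sum is
    1.\<close>
  have "card W = 1" using cW p_pos by simp
  moreover have "0 \<in> W" using W by (simp add: nondeg_def)
  ultimately have "W = {0}" by (auto simp: card_1_singleton_iff One_nat_def)
  then have W1: "(\<Sum>x\<in>W. psi p k (x ^ 2)) = 1" by (simp add: psi_def tr_0 chi_0)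
  obtain D where D: "D \<in> GF 1" "D \<noteq> 0" "(\<Prod>i<k. tr p 1 k (v i * v i)) = D ^ 2"
    by (rule discriminant_square[OF k(1,3), of v]) (use v that in blast)+
  have "(\<Prod>i\<in>A. tr p 1 k (v i * v i)) \<in> GF 1 \<and>
      (\<Prod>i\<in>A. eta p (tr p 1 k (v i * v i))) = eta p (\<Prod>i\<in>A. tr p 1 k (v i * v i))"
    if "finite A" "A \<subseteq> {..<k}" for A using that
  proof (induction A)
    case empty
    then show ?case by (simp add: GF_1 eta_def)
  next
    case (insert i A)
    then have "tr p 1 k (v i * v i) \<in> GF 1" using v(1)[of i] by (intro tr_mem GF_mult) auto
    then show ?case using insert F1.eta_mult by (simp add: GF_mult)
  qed
  then have "(\<Prod>i<k. eta p (tr p 1 k (v i * v i))) = eta p (D ^ 2)" using D(3) by simp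
  also have "\<dots> = 1" using F1.eta_square D by simp
  finally show ?thesis using S W1 gauss_sum_GF_1 by simp
qed

end

section \<open>Points on the unit circle\<close>

lemma root_of_unity_norm:
  fixes \<zeta> :: complex
  assumes "p > 0" "\<zeta> ^ p = 1"
  shows "norm \<zeta> = 1"
  using power_eq_1_iff[OF assms(2)] assms(1) by simp

text \<open>The powers of the root sum to 0, so p is the sum of the numbers 1 - \<zeta>^j; each has
  norm at most j times that of 1 - \<zeta>, and the j add up to p (p - 1) / 2.\<close>

lemma root_of_unity_dist:
  fixes \<zeta> :: complex
  assumes "p > 1" "\<zeta> ^ p = 1" "\<zeta> \<noteq> 1"
  shows "norm (1 - \<zeta>) * (real p - 1) \<ge> 2"
proof -
  have n1: "norm \<zeta> = 1"
    using assms root_of_unity_norm[of p \<zeta>] by simp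
  have "(1 - \<zeta>) * (\<Sum>j<p. \<zeta> ^ j) = 0"
    using one_diff_power_eq[of \<zeta> p] assms by simp
  then have "(\<Sum>j<p. \<zeta> ^ j) = 0" using assms by simp
  then have "of_nat p = (\<Sum>j<p. 1 - \<zeta> ^ j)" by (simp add: sum_subtractf)
  then have "real p = norm (\<Sum>j<p. 1 - \<zeta> ^ j)" by (metis norm_of_nat)
  also have "\<dots> \<le> (\<Sum>j<p. norm (1 - \<zeta> ^ j))" by (rule norm_sum)
  also have "\<dots> \<le> (\<Sum>j<p. real j * norm (1 - \<zeta>))"
  proof (rule sum_mono)
    fix j
    show "norm (1 - \<zeta> ^ j) \<le> real j * norm (1 - \<zeta>)"
      using norm_power_diff[of 1 \<zeta> j] n1 by simp
  qed
  also have "\<dots> = (real p * (real p - 1) / 2) * norm (1 - \<zeta>)"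
  proof -
    have "(\<Sum>j<p. real j) = real p * (real p - 1) / 2"
      by (induction p) (simp_all add: field_simps)
    then show ?thesis by (simp add: sum_distrib_right[symmetric])
  qed
  finally have "real p * 2 \<le> real p * (norm (1 - \<zeta>) * (real p - 1))" by (simp add: field_simps)
  then show ?thesis using assms(1) by (subst (asm) mult_le_cancel_left_pos) auto
qed

text \<open>If \<open>z1\<close> and \<open>w\<close> differ, \<open>root_of_unity_dist\<close> for
  z1 / w and \<open>p \<le> q\<close> make the right-hand side at least 2 in norm. On the unit
  circle this leaves only \<open>z0 = -1\<close>, whose odd powers are not 1.\<close>

lemma root_of_unity_rigidity:
  fixes z0 z1 w :: complex
  assumes p: "odd p" "p > 1" "p \<le> q" and z: "z0 ^ p = 1" "z1 ^ p = 1" "w ^ p = 1"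
    and eq: "1 - z0 = (real q - 1) * (z1 - w)"
  shows "z1 = w"
proof (rule ccontr)
  assume ne: "z1 \<noteq> w"
  have n1: "norm \<zeta> = 1" if "\<zeta> ^ p = 1" for \<zeta> :: complex
    using that p root_of_unity_norm[of p \<zeta>] by simp
  have "w \<noteq> 0" using n1[OF z(3)] by auto
  have "norm (1 - z1 / w) * (real p - 1) \<ge> 2"
    using ne z p \<open>w \<noteq> 0\<close> by (intro root_of_unity_dist) (auto simp: power_divide)
  moreover have "norm (1 - z1 / w) = norm (z1 - w)"
  proof -
    have "1 - z1 / w = (w - z1) / w" using \<open>w \<noteq> 0\<close> by (simp add: field_simps)
    then show ?thesis by (simp add: norm_divide n1[OF z(3)] norm_minus_commute)
  qed
  moreover have "norm (z1 - w) * (real p - 1) \<le> norm (z1 - w) * (real q - 1)"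
    using p by (intro mult_left_mono) auto
  moreover have "norm (1 - z0) = norm (z1 - w) * (real q - 1)"
  proof -
    have "norm (1 - z0) = norm (of_real (real q - 1) * (z1 - w))" using eq by simp
    also have "\<dots> = \<bar>real q - 1\<bar> * norm (z1 - w)" by (simp only: norm_mult norm_of_real)
    finally show ?thesis using p by simp
  qed
  ultimately have ge: "norm (1 - z0) \<ge> 2" by (metis order_trans)
  \<comment> \<open>Parallelogram law for 1 and \<open>z0\<close>.\<close>
  have "(norm (1 - z0))\<^sup>2 + (norm (1 + z0))\<^sup>2 = 2 + 2 * (norm z0)\<^sup>2"
    unfolding cmod_power2 by (simp add: power2_eq_square algebra_simps)
  then have "(norm (1 - z0))\<^sup>2 + (norm (1 + z0))\<^sup>2 = 4" using n1[OF z(1)] by simp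
  moreover have "(norm (1 - z0))\<^sup>2 \<ge> 4" using power_mono[OF ge, of 2] by simp
  ultimately have "(norm (1 + z0))\<^sup>2 \<le> 0" by linarith
  then have "z0 = -1" by (simp add: add_eq_0_iff)
  then show False using z(1) p(1) by simp
qed

section \<open>Norm-one elements of the quadratic extension of the field with q elements\<close>

locale half_circle = gf p "2 * m" ty for p m :: nat and ty :: "'a::{field,finite} itself" +
  fixes \<xi> :: 'a
  assumes odd_m: "odd m"
    and xi_U: "\<xi> ^ (p ^ m + 1) = 1"
    and xi_gen: "x ^ (p ^ m + 1) = 1 \<Longrightarrow> \<exists>j. x = \<xi> ^ j"
begin

definition q where "q = p ^ m"
definition N where "N = (q + 1) div 4"

lemma m_pos: "m > 0" using odd_m by (rule odd_pos)

sublocale Fq: char_field "GF m" q "psi p m"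
  unfolding q_def by (rule psi_char_field) (use odd_m m_pos in auto)

lemma q_N: "q + 1 = 4 * N" and half_N: "Fq.half + 1 = 2 * N" and N_pos: "N > 0" and q_ge: "q \<ge> 3"
proof -
  show 1: "q + 1 = 4 * N"
  proof -
    obtain t where "q = 4 * t + 3" using Fq.Q_mod by (metis mult_div_mod_eq)
    then show ?thesis by (simp add: N_def)
  qed
  show "Fq.half + 1 = 2 * N" using 1 Fq.half_pos unfolding Fq.half_def by linarith
  show "q \<ge> 3" using Fq.Q_mod mod_less_eq_dividend[of q 4] by simp
  then show "N > 0" using 1 by linarith
qed

lemma frob_q: "x ^ q ^ 2 = x" for x :: 'a
proof (cases "x = 0")
  case False
  have "p ^ (2 * m) = Suc (p ^ (2 * m) - 1)" using p_pos by simp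
  then have "x ^ (p ^ (2 * m)) = x * x ^ (p ^ (2 * m) - 1)" by (metis power_Suc)
  then show ?thesis using finite_field_fermat[OF False]
    by (simp add: card_UNIV q_def power_mult[symmetric] mult.commute)
qed (use q_ge in simp)

lemma GF_2m: "GF (2 * m) = UNIV"
  using frob_q by (auto simp: GF_iff q_def power_mult[symmetric] mult.commute)

lemma q_add: "(x + y) ^ q = x ^ q + y ^ q" and q_diff: "(x - y) ^ q = x ^ q - y ^ q" for x y :: 'a
  by (simp_all add: q_def frob_add frob_diff)

lemma four_nz: "(4::'a) \<noteq> 0"
proof -
  have "(2::'a) * 2 \<noteq> 0" using two_nz by (simp only: mult_eq_0_iff) simp
  then show ?thesis by simp
qed

lemma GFm_iff: "x \<in> GF m \<longleftrightarrow> x ^ q = x"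
  by (simp add: GF_iff q_def)

lemma q_Suc: "q = Suc (q - 1)" using q_ge by simp

lemma GFm_nz_iff: "x \<noteq> 0 \<Longrightarrow> x \<in> GF m \<longleftrightarrow> x ^ (q - 1) = 1"
  unfolding GFm_iff by (subst q_Suc) simp

lemma tr_2m: "tr p 1 (2 * m) y = tr p 1 m (y + y ^ q)" for y :: 'a
proof -
  have "tr p 1 (2 * m) y = (\<Sum>i<m. y ^ (p ^ i)) + (\<Sum>i<m. y ^ (p ^ (m + i)))"
  proof -
    have "(\<Sum>i<m + j. y ^ (p ^ i)) = (\<Sum>i<m. y ^ (p ^ i)) + (\<Sum>i<j. y ^ (p ^ (m + i)))" for j
      by (induction j) (simp_all add: add.assoc)
    then show ?thesis by (simp only: tr_1_eq mult_2)
  qed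
  also have "(\<Sum>i<m. y ^ (p ^ (m + i))) = tr p 1 m (y ^ q)"
    by (simp add: tr_1_eq q_def power_mult[symmetric] power_add[symmetric])
  finally show ?thesis by (simp add: tr_add) (simp add: tr_1_eq)
qed

lemma trace_mem: "y + y ^ q \<in> GF m" for y :: 'a
  using frob_q[of y] by (simp add: GFm_iff q_add power_mult[symmetric] power2_eq_square add.commute)

lemma card_UNIV_q: "card (UNIV :: 'a set) - 1 = (q - 1) * (q + 1)"
proof -
  obtain r where r: "q = Suc r" using q_Suc by blast
  have "card (UNIV :: 'a set) = q * q"
    by (simp add: card_UNIV q_def mult_2 power_add)
  then show ?thesis by (simp add: r algebra_simps)
qed

definition U :: "'a set" where "U = {z. z ^ (q + 1) = 1}"

lemma card_U: "card U = q + 1"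
  unfolding U_def
proof (rule card_power_eq[of _ "q - 1"])
  show "(q + 1) * (q - 1) = card (UNIV :: 'a set) - 1" by (simp only: card_UNIV_q mult.commute)
qed simp

lemma card_fiber: "u \<in> U \<Longrightarrow> card {x. x ^ (q - 1) = u} = q - 1"
proof (rule card_power_eq[of _ "q + 1"])
  show "(q - 1) * (q + 1) = card (UNIV :: 'a set) - 1" by (simp only: card_UNIV_q)
qed (simp add: U_def)

lemma power_q_1_in_U: "x \<noteq> 0 \<Longrightarrow> x ^ (q - 1) \<in> U"
proof -
  assume x: "x \<noteq> 0"
  obtain r where r: "q = Suc r" using q_Suc by blast
  have "x * (x ^ (q - 1)) ^ (q + 1) = x * (x ^ r) ^ (r + 2)"
  proof -
    have "q - 1 = r" "q + 1 = r + 2" by (simp_all add: r)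
    then show ?thesis by (simp only:)
  qed
  also have "\<dots> = x ^ Suc (r * (r + 2))" by (simp only: power_mult power_Suc)
  also have "Suc (r * (r + 2)) = q ^ 2" by (simp add: r power2_eq_square)
  finally show ?thesis using x frob_q[of x] by (simp add: U_def)
qed

lemma U_nz: "z \<in> U \<Longrightarrow> z \<noteq> 0" by (auto simp: U_def power_0_left)

lemma U_conj: "z \<in> U \<Longrightarrow> z ^ q = 1 / z"
  using U_nz[of z] by (simp add: U_def power_add field_simps)

lemma U_half: "z \<in> U \<Longrightarrow> z ^ (2 * N) = 1 \<or> z ^ (2 * N) = -1"
proof -
  assume "z \<in> U"
  then have "(z ^ (2 * N)) ^ 2 = 1"
    by (simp add: U_def power_mult[symmetric] q_N mult.commute) 
  then show ?thesis by (simp add: power2_eq_1_iff)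
qed

lemma half_in_U: "z ^ (2 * N) = -1 \<Longrightarrow> z \<in> U"
proof -
  assume "z ^ (2 * N) = -1"
  then have "(z ^ (2 * N)) ^ 2 = 1" by simp
  then show ?thesis by (simp add: U_def power_mult[symmetric] q_N mult.commute)
qed

definition im where "im = \<xi> ^ N"

text \<open>A generator of \<open>U\<close> cannot satisfy \<open>\<xi> ^ (2 * N) = 1\<close>, since
  then all \<open>4 * N\<close> elements of \<open>U\<close> would be roots of an equation of degree
  \<open>2 * N\<close>.\<close>

lemma im_square: "im ^ 2 = -1"
proof -
  have xU: "\<xi> \<in> U" using xi_U by (simp add: U_def q_def)
  have "\<xi> ^ (2 * N) \<noteq> 1"
  proof
    assume 1: "\<xi> ^ (2 * N) = 1"
    have "U \<subseteq> {z. z ^ (2 * N) = 1}"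
    proof
      fix z assume "z \<in> U"
      then obtain j where "z = \<xi> ^ j" using xi_gen[of z] by (auto simp: U_def q_def)
      then have "z ^ (2 * N) = (\<xi> ^ (2 * N)) ^ j" by (simp add: power_mult[symmetric] mult.commute)
      then show "z \<in> {z. z ^ (2 * N) = 1}" by (simp add: 1)
    qed
    then have "card U \<le> card {z::'a. z ^ (2 * N) = 1}" by (intro card_mono) auto
    also have "\<dots> \<le> 2 * N" using N_pos by (intro card_power_eq_le) simp
    finally show False using card_U q_N N_pos by simp
  qed
  then have "\<xi> ^ (2 * N) = -1" using U_half[OF xU] by blast
  then show ?thesis by (simp add: im_def power_mult[symmetric] mult.commute)
qed

lemma im_conj: "im ^ q = - im"
proof -
  have 4: "im ^ 4 = 1" using im_square by (simp add: power4_eq_xxxx power2_eq_square)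
  have "q = 4 * (q div 4) + 3" using Fq.Q_mod by (metis mult_div_mod_eq)
  then have "im ^ q = im ^ (4 * (q div 4) + 3)" by (rule arg_cong)
  also have "\<dots> = im ^ 3" by (simp add: power_add power_mult 4)
  also have "\<dots> = im ^ 2 * im" by (simp add: power2_eq_square power3_eq_cube)
  finally show ?thesis by (simp add: im_square)
qed

text \<open>The element is (z + 1)^2 / z, and conjugation sends z + 1 to (z + 1) / z. Hence Euler's
  power depends only on \<open>z ^ (2 * N)\<close>, that is, on whether z is a square in
  \<open>U\<close>.\<close>

lemma eta_plus_2:
  assumes z: "z \<in> U" "z \<noteq> -1"
  shows "z + 1 / z + 2 \<noteq> 0" "(z + 1 / z + 2) ^ Fq.half = 1 / z ^ (2 * N)"
proof -
  have z0: "z \<noteq> 0" "z + 1 \<noteq> 0" using U_nz z by (auto simp: add_eq_0_iff2)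
  have eq: "z + 1 / z + 2 = (z + 1) ^ 2 / z" using z0 by (simp add: field_simps power2_eq_square)
  show "z + 1 / z + 2 \<noteq> 0" unfolding eq using z0 by simp
  have "(z + 1) * (z + 1) ^ (q - 1) = (z + 1) ^ q" by (subst (2) q_Suc) simp
  also have "\<dots> = (z + 1) * (1 / z)" using z0 U_conj[OF z(1)] by (simp add: q_add field_simps)
  finally have "(z + 1) ^ (q - 1) = 1 / z" using z0 by (metis mult_left_cancel)
  moreover have "2 * Fq.half = q - 1" using half_N q_N by linarith
  ultimately have "((z + 1) ^ 2) ^ Fq.half = 1 / z" by (simp add: power_mult[symmetric])
  then show "(z + 1 / z + 2) ^ Fq.half = 1 / z ^ (2 * N)"
    unfolding eq half_N[symmetric] by (simp add: power_divide power_add mult.commute)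
qed

text \<open>As in \<open>eta_plus_2\<close>, but conjugation sends z - 1 to -(z - 1) / z, whence the
  extra sign.\<close>

lemma eta_minus_2:
  assumes z: "z \<in> U" "z \<noteq> 1"
  shows "z + 1 / z - 2 \<noteq> 0" "(z + 1 / z - 2) ^ Fq.half = - 1 / z ^ (2 * N)"
proof -
  have z0: "z \<noteq> 0" "z - 1 \<noteq> 0" using U_nz z by auto
  have eq: "z + 1 / z - 2 = (z - 1) ^ 2 / z" using z0 by (simp add: field_simps power2_eq_square)
  show "z + 1 / z - 2 \<noteq> 0" unfolding eq using z0 by simp
  have "(z - 1) * (z - 1) ^ (q - 1) = (z - 1) ^ q" by (subst (2) q_Suc) simp
  also have "\<dots> = (z - 1) * (- 1 / z)" using z0 U_conj[OF z(1)] by (simp add: q_diff field_simps)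
  finally have "(z - 1) ^ (q - 1) = - 1 / z" using z0 by (metis mult_left_cancel)
  moreover have "2 * Fq.half = q - 1" using half_N q_N by linarith
  ultimately have "((z - 1) ^ 2) ^ Fq.half = - 1 / z" by (simp add: power_mult[symmetric])
  then show "(z + 1 / z - 2) ^ Fq.half = - 1 / z ^ (2 * N)"
    unfolding eq half_N[symmetric] by (simp add: power_divide power_add mult.commute)
qed

text \<open>A nonsquare z of \<open>U\<close> makes t + 2 a nonsquare and t - 2 a square; conversely
  such a t comes from exactly the two points z and 1 / z. The right-hand side is 2 in this case and
  0 otherwise.\<close>

lemma card_nonsquare_points:
  assumes t: "t \<in> GF m"
  shows "complex_of_nat (card {z. z ^ (2 * N) = -1 \<and> z + 1 / z = t}) =
    (1 - eta q (t + 2)) * (1 + eta q (t - 2)) / 2"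
proof (cases "\<exists>z. z ^ (2 * N) = -1 \<and> z + 1 / z = t")
  case True
  then obtain z where z: "z ^ (2 * N) = -1" "z + 1 / z = t" by blast
  then have zU: "z \<in> U" using half_in_U by blast
  have z1: "z \<noteq> 1" "z \<noteq> -1" using z(1) Fq.one_neq_minus_one by auto
  have e: "eta q (t + 2) = -1" "eta q (t - 2) = 1"
    using eta_plus_2[OF zU z1(2)] eta_minus_2[OF zU z1(1)] z Fq.one_neq_minus_one
    by (auto simp: Fq.eta_eq)
  have z0: "z \<noteq> 0" using U_nz[OF zU] .
  have "{z. z ^ (2 * N) = -1 \<and> z + 1 / z = t} = {z, 1 / z}"
  proof (intro equalityI subsetI)
    fix y assume y: "y \<in> {z. z ^ (2 * N) = -1 \<and> z + 1 / z = t}"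
    then have "y \<noteq> 0" using U_nz half_in_U by blast
    moreover have "y + 1 / y = z + 1 / z" using y z by simp
    ultimately have "(y - z) * (y * z - 1) = 0" using z0 by (simp add: field_simps)
    then have "y = z \<or> y * z = 1" by simp
    then show "y \<in> {z, 1 / z}" using z0 by (auto simp: field_simps)
  next
    fix y assume "y \<in> {z, 1 / z}"
    then show "y \<in> {z. z ^ (2 * N) = -1 \<and> z + 1 / z = t}"
      using z by (auto simp: power_divide add.commute)
  qed
  moreover have "z \<noteq> 1 / z"
  proof
    assume "z = 1 / z"
    then have "z ^ 2 = 1" using z0 by (simp add: field_simps power2_eq_square)
    then show False using z1 by (simp add: power2_eq_1_iff)
  qed
  ultimately show ?thesis by (simp add: e)
next
  case False
  then have emp: "{z. z ^ (2 * N) = -1 \<and> z + 1 / z = t} = {}" by blast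
  have tm: "t + 2 \<in> GF m" "t - 2 \<in> GF m" using t Fq.two_mem by (auto intro: GF_add GF_diff)
  have "\<not> (eta q (t + 2) = -1 \<and> eta q (t - 2) = 1)"
  proof
    assume e: "eta q (t + 2) = -1 \<and> eta q (t - 2) = 1"
    have "eta q (- ((t + 2) * (t - 2))) = 1"
      using e Fq.eta_minus[OF Fq.mult_mem[OF tm]] Fq.eta_mult[OF tm] by simp
    then obtain r where r: "r \<in> GF m" "r ^ 2 = - ((t + 2) * (t - 2))"
      using Fq.eta_sqrt[of "- ((t + 2) * (t - 2))"] tm by (metis GF_mult GF_minus)
    \<comment> \<open>The roots of z^2 - t z + 1. The discriminant (t + 2)(t - 2) is the square of
      \<open>im * r\<close>; conjugation negates \<open>im\<close>, so it swaps the roots, and their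
      product 1 puts them in \<open>U\<close>.\<close>
    define z where "z = (t + im * r) / 2"
    define z' where "z' = (t - im * r) / 2"
    have "z * z' = (t ^ 2 - im ^ 2 * r ^ 2) / 4"
      by (simp add: z_def z'_def power2_eq_square algebra_simps)
    also have "t ^ 2 - im ^ 2 * r ^ 2 = 2 * 2"
      unfolding im_square r(2) by (simp add: power2_eq_square algebra_simps)
    finally have zz: "z * z' = 1" using two_nz
      by (metis divide_self mult_eq_0_iff numeral_Bit0 numeral_One mult_2 one_add_one)
    have "z + z' = (t + im * r + (t - im * r)) / 2" by (simp only: z_def z'_def add_divide_distrib)
    then have sum: "z + z' = t" using two_nz by (simp add: mult_2[symmetric])
    have "z ^ q = z'" unfolding z_def z'_def using t r Fq.two_mem im_conj
      by (simp add: power_divide q_add power_mult_distrib GFm_iff)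
    then have zU: "z \<in> U" using zz by (simp add: U_def power_add mult.commute)
    have z0: "z \<noteq> 0" using zz by auto
    have "1 / z = z'" using zz z0 by (simp add: field_simps)
    then have zt: "z + 1 / z = t" using sum by simp
    then have "z ^ (2 * N) = 1" using False U_half[OF zU] by blast
    moreover have "z \<noteq> -1"
    proof
      assume "z = -1"
      then have "t + 2 = 0" using zt by auto
      then show False using e by (simp add: eta_def)
    qed
    ultimately have "eta q (t + 2) = 1" using eta_plus_2[OF zU] zt by (auto simp: Fq.eta_eq)
    then show False using e by auto
  qed
  moreover have "eta q (t + 2) = 1 \<or> eta q (t + 2) = -1 \<or> t = -2" using Fq.eta_cases[OF tm(1)]
    by (auto simp: add_eq_0_iff2)
  moreover have "eta q (t - 2) = 1 \<or> eta q (t - 2) = -1 \<or> t = 2" using Fq.eta_cases[OF tm(2)] by auto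
  \<comment> \<open>For t = 2 or t = -2 one character is 0; the factor with the other one vanishes,
    because 4 is a square and -4 is not.\<close>
  moreover have "eta q ((2::'a) + 2) = 1"
    using Fq.eta_square[OF Fq.two_mem two_nz] by (simp add: power2_eq_square)
  moreover have "eta q ((-2::'a) - 2) = -1"
  proof -
    have "eta q (- ((2::'a) + 2)) = - eta q ((2::'a) + 2)"
      using Fq.two_mem by (intro Fq.eta_minus GF_add)
    then show ?thesis using calculation(4) by simp
  qed
  ultimately have "(1 - eta q (t + 2)) * (1 + eta q (t - 2)) = 0" by auto
  then show ?thesis unfolding emp by simp
qed

text \<open>Completing the square with x = 2 y - t reduces the count to square roots of the
  discriminant.\<close>

lemma card_hyperbola_points:
  assumes t: "t \<in> GF m"
  shows "complex_of_nat (card {y\<in>GF m - {0}. y + 1 / y = t}) = 1 + eta q ((t + 2) * (t - 2))"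
proof -
  have tm: "t + 2 \<in> GF m" "t - 2 \<in> GF m" using t Fq.two_mem by (auto intro: GF_add GF_diff)
  have "bij_betw (\<lambda>y. 2 * y - t) {y\<in>GF m - {0}. y + 1 / y = t} {x\<in>GF m. x ^ 2 = (t + 2) * (t - 2)}"
  proof (rule bij_betw_byWitness[where f' = "\<lambda>x. (x + t) / 2"])
    show "(\<lambda>y. 2 * y - t) ` {y\<in>GF m - {0}. y + 1 / y = t} \<subseteq> {x\<in>GF m. x ^ 2 = (t + 2) * (t - 2)}"
    proof (rule image_subsetI)
      fix y assume "y \<in> {y\<in>GF m - {0}. y + 1 / y = t}"
      then have y: "y \<in> GF m" "y \<noteq> 0" "t = y + 1 / y" by auto
      have "2 * y - (y + 1 / y) = y - 1 / y" by simp
      moreover have "(y - 1 / y) ^ 2 = (y + 1 / y + 2) * (y + 1 / y - 2)"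
        using y(2) by (simp add: field_simps power2_eq_square)
      moreover have "y - 1 / y \<in> GF m" using y(1) by (intro GF_diff GF_divide GF_1)
      ultimately show "2 * y - t \<in> {x\<in>GF m. x ^ 2 = (t + 2) * (t - 2)}"
        by (simp add: y(3))
    qed
    show "(\<lambda>x. (x + t) / 2) ` {x\<in>GF m. x ^ 2 = (t + 2) * (t - 2)} \<subseteq> {y\<in>GF m - {0}. y + 1 / y = t}"
    proof (rule image_subsetI)
      fix x assume "x \<in> {x\<in>GF m. x ^ 2 = (t + 2) * (t - 2)}"
      then have x: "x \<in> GF m" "x ^ 2 = (t + 2) * (t - 2)" by auto
      have "(x + t) * (t - x) = 2 * 2"
        using x(2) by (simp add: power2_eq_square algebra_simps)
      then have prod: "(x + t) / 2 * ((t - x) / 2) = 1" using four_nz by (simp add: times_divide_times_eq)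
      then have nz: "(x + t) / 2 \<noteq> 0" by (metis mult_zero_left zero_neq_one)
      have inv: "1 / ((x + t) / 2) = (t - x) / 2" using prod nz by (metis nonzero_eq_divide_eq mult.commute)
      have "(x + t) / 2 + (t - x) / 2 = t" using two_nz by (simp add: add_divide_distrib[symmetric])
      moreover have "(x + t) / 2 \<in> GF m" using x(1) t Fq.two_mem by (intro GF_divide GF_add)
      moreover have "(x + t) / 2 + 1 / ((x + t) / 2) = (x + t) / 2 + (t - x) / 2" by (simp only: inv)
      ultimately show "(x + t) / 2 \<in> {y\<in>GF m - {0}. y + 1 / y = t}"
        using nz by simp
    qed
  qed (use two_nz in \<open>auto simp: field_simps\<close>)
  then show ?thesis
    using Fq.card_sqrt[OF Fq.mult_mem[OF tm]] by (simp add: bij_betw_same_card)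
qed

end

section \<open>Half-circle sums and Kloosterman sums\<close>

lemma Re_chi: "Re (chi p x) = cos (2 * pi * real (fp_val p x) / real p)"
  and Im_chi: "Im (chi p x) = sin (2 * pi * real (fp_val p x) / real p)"
  by (simp_all add: chi_def omega_def)

context half_circle
begin

lemma U_trace_mem: "z \<in> U \<Longrightarrow> z + 1 / z \<in> GF m"
  using trace_mem[of z] U_conj[of z] by simp

lemma chi_root: "chi p x ^ p = 1"
proof -
  have "chi p x ^ p = omega p (p * fp_val p x)" by (simp only: chi_def omega_mult[symmetric] mult.commute)
  then show ?thesis by (simp only: omega_mult omega_self[OF p_pos(1)] power_one)
qed

text \<open>With y = c x the argument becomes c (y + 1 / y). Grouping by t = y + 1 / y brings in the
  count of \<open>card_hyperbola_points\<close>, whose constant part sums to 0.\<close>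

lemma Kloost_eq:
  assumes c: "c \<in> GF m" "c \<noteq> 0"
  shows "Kloost p m (c ^ 2) = 1 + (\<Sum>t\<in>GF m. eta q ((t + 2) * (t - 2)) * psi p m (c * t))"
proof -
  have inv: "x ^ (p ^ m - 2) = inverse x" if x: "x \<in> GF m" "x \<noteq> 0" for x
  proof -
    have "x ^ (q - 2) * x = x ^ (q - 1)" using q_ge by (simp add: power_Suc2[symmetric] del: power_Suc) (simp add: Suc_diff_Suc numeral_2_eq_2 One_nat_def)
    also have "\<dots> = 1" using GFm_nz_iff x by blast
    finally show ?thesis unfolding q_def by (metis inverse_unique mult.commute)
  qed
  have "p ^ m - 2 > 0" using q_ge by (simp add: q_def)
  have scale: "c ^ 2 * x + x ^ (p ^ m - 2) = c * (c * x + 1 / (c * x))" if "x \<in> GF m" "x \<noteq> 0" for x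
    using that c by (simp add: inv divide_inverse power2_eq_square distrib_left)
  have "Kloost p m (c ^ 2) = (\<Sum>x\<in>GF m. psi p m (c ^ 2 * x + x ^ (p ^ m - 2)))"
    by (simp add: Kloost_def psi_def chi_def)
  \<comment> \<open>The element 0 contributes 1, since \<open>0 ^ (p ^ m - 2)\<close> is 0 for q at
    least 3.\<close>
  also have "\<dots> = psi p m (0::'a) + (\<Sum>x\<in>GF m - {0}. psi p m (c ^ 2 * x + x ^ (p ^ m - 2)))"
    using \<open>p ^ m - 2 > 0\<close> by (subst sum.remove[of _ 0]) (simp_all add: GF_0 power_0_left)
  also have "(\<Sum>x\<in>GF m - {0}. psi p m (c ^ 2 * x + x ^ (p ^ m - 2))) = (\<Sum>y\<in>GF m - {0}. psi p m (c * (y + 1 / y)))"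
    by (rule sum.reindex_bij_witness[of _ "\<lambda>y. y / c" "\<lambda>x. c * x"])
      (use c in \<open>auto simp: GF_mult GF_divide scale\<close>)
  also have "\<dots> = (\<Sum>t\<in>GF m. of_nat (card {y\<in>GF m - {0}. y + 1 / y = t}) * psi p m (c * t))"
    by (rule sum_image_card) (auto intro: GF_add GF_divide GF_1)
  also have "\<dots> = (\<Sum>t\<in>GF m. (1 + eta q ((t + 2) * (t - 2))) * psi p m (c * t))"
    by (rule sum.cong[OF refl]) (simp only: card_hyperbola_points)
  also have "\<dots> = (\<Sum>t\<in>GF m. eta q ((t + 2) * (t - 2)) * psi p m (c * t))"
    using Fq.psi_scaled_sum[OF c] by (simp add: distrib_right sum.distrib)
  finally show ?thesis by (simp add: Fq.psi_0)
qed

lemma eta_shifted_sum: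
  assumes c: "c \<in> GF m" "c \<noteq> 0" and s: "s \<in> GF m"
  shows "(\<Sum>t\<in>GF m. eta q (t + s) * psi p m (c * t)) = psi p m (- (c * s)) * eta q c * Fq.gauss_sum"
proof -
  have "(\<Sum>t\<in>GF m. eta q (t + s) * psi p m (c * t)) = (\<Sum>t\<in>GF m. eta q t * psi p m (c * (t - s)))"
    by (rule sum.reindex_bij_witness[of _ "\<lambda>t. t - s" "\<lambda>t. t + s"]) (auto simp: s GF_add GF_diff)
  also have "\<dots> = (\<Sum>t\<in>GF m. psi p m (- (c * s)) * (eta q t * psi p m (c * t)))"
  proof (rule sum.cong[OF refl])
    fix t assume t: "t \<in> GF m"
    have "c * (t - s) = - (c * s) + c * t" by (simp add: algebra_simps)
    then have "psi p m (c * (t - s)) = psi p m (- (c * s)) * psi p m (c * t)"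
      using t s c by (simp only: Fq.psi_add GF_mult GF_minus)
    then show "eta q t * psi p m (c * (t - s)) = psi p m (- (c * s)) * (eta q t * psi p m (c * t))" by simp
  qed
  also have "\<dots> = psi p m (- (c * s)) * (eta q c * Fq.gauss_sum)"
    by (simp only: sum_distrib_left[symmetric] Fq.eta_scaled_sum[OF c])
  finally show ?thesis by simp
qed

text \<open>\<open>Iconst\<close> is built on (-i)^m, the Gauss sum on i^m; for odd \<open>m\<close>
  they are negatives of each other.\<close>

lemma gauss_sum_Iconst: "Fq.gauss_sum = -2 * Iconst p m"
proof -
  have "Fq.gauss_sum = (\<i> * complex_of_real (sqrt (real p))) ^ m"
    unfolding Fq.gauss_sum_def using odd_m m_pos by (intro gauss_sum_GF) auto
  also have "\<dots> = \<i> ^ m * complex_of_real (sqrt (real p ^ m))"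
    by (simp add: power_mult_distrib real_sqrt_power)
  also have "\<i> ^ m = - ((- \<i>) ^ m)" using odd_m by (simp add: power_minus_odd)
  also have "(- \<i>) ^ m = cis (3 * real m * pi / 2)"
  proof -
    have "- \<i> = cis (3/2 * pi)"
    proof -
      have "cis (pi + pi / 2) = - \<i>" unfolding cis_mult[symmetric] by simp
      then show ?thesis by (simp add: field_simps)
    qed
    then have "(- \<i>) ^ m = cis (real m * (3/2 * pi))" by (simp only: DeMoivre)
    also have "real m * (3/2 * pi) = 3 * real m * pi / 2" by simp
    finally show ?thesis .
  qed
  finally show ?thesis using p_mod by (simp add: Iconst_def)
qed

text \<open>The exponent (q + 1) / 2 in \<open>Qfun\<close> multiplies c by its own quadratic
  character, and as the sine is odd this sign can be pulled out.\<close>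

lemma eta_sin:
  assumes c: "c \<in> GF m" "c \<noteq> 0"
  shows "eta q c * (psi p m (2 * c) - psi p m (- (2 * c))) =
    2 * \<i> * complex_of_real (sin (2 * pi * real (Qfun p m c) / real p))"
proof -
  have "(p ^ m + 1) div 2 = Fq.half + 1" using q_N half_N unfolding q_def by simp
  then have "Qfun p m c = fp_val p (2 * tr p 1 m (c * c ^ Fq.half))" by (simp add: Qfun_def power_add mult.commute)
  moreover have "2 * tr p 1 m x = tr p 1 m (2 * x)" for x :: 'a
    by (simp only: mult_2 tr_add)
  ultimately have S: "sin (2 * pi * real (Qfun p m c) / real p) = Im (psi p m (2 * (c * c ^ Fq.half)))"
    by (simp add: psi_def Im_chi)
  have c2: "2 * c \<in> GF m" using c Fq.two_mem by (simp add: GF_mult)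
  have D: "psi p m (2 * c) - psi p m (- (2 * c)) = 2 * \<i> * complex_of_real (Im (psi p m (2 * c)))"
    unfolding Fq.psi_minus[OF c2] by (simp add: complex_eq_iff)
  show ?thesis
  proof (cases "c ^ Fq.half = 1")
    case True
    then show ?thesis using c D by (simp add: S Fq.eta_eq)
  next
    case False
    then have "c ^ Fq.half = -1" using Fq.power_half c by blast
    moreover have "psi p m (- (2 * c)) = cnj (psi p m (2 * c))" by (rule Fq.psi_minus[OF c2])
    ultimately show ?thesis using c D False by (simp add: S Fq.eta_eq)
  qed
qed

text \<open>The product of the two characters from \<open>card_nonsquare_points\<close> expands into
  four sums: a vanishing one, two shifted Gauss sums that combine to the sine, and the Kloosterman
  sum less 1.\<close>

lemma half_circle_sum:
  assumes c: "c \<in> GF m" "c \<noteq> 0"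
  shows "2 * (\<Sum>z | z ^ (2 * N) = -1. psi p m (c * (z + 1 / z))) =
    1 - Kloost p m (c ^ 2) - 4 * Iconst p m * \<i> * complex_of_real (sin (2 * pi * real (Qfun p m c) / real p))"
proof -
  let ?\<psi> = "psi p m" and ?G = Fq.gauss_sum
  have "(\<Sum>z | z ^ (2 * N) = -1. ?\<psi> (c * (z + 1 / z))) =
      (\<Sum>t\<in>GF m. of_nat (card {z\<in>{z. z ^ (2 * N) = -1}. z + 1 / z = t}) * ?\<psi> (c * t))"
    by (rule sum_image_card) (auto intro: U_trace_mem half_in_U)
  also have "\<dots> = (\<Sum>t\<in>GF m. (1 - eta q (t + 2)) * (1 + eta q (t - 2)) / 2 * ?\<psi> (c * t))"
    by (rule sum.cong[OF refl]) (simp only: card_nonsquare_points mem_Collect_eq)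
  finally have "2 * (\<Sum>z | z ^ (2 * N) = -1. ?\<psi> (c * (z + 1 / z))) =
      (\<Sum>t\<in>GF m. (1 - eta q (t + 2)) * (1 + eta q (t - 2)) * ?\<psi> (c * t))"
    by (simp add: sum_distrib_left)
  also have "\<dots> = (\<Sum>t\<in>GF m. ?\<psi> (c * t) + eta q (t + (- 2)) * ?\<psi> (c * t) - eta q (t + 2) * ?\<psi> (c * t)
      - eta q ((t + 2) * (t - 2)) * ?\<psi> (c * t))"
  proof (rule sum.cong[OF refl])
    fix t assume "t \<in> GF m"
    then have "eta q ((t + 2) * (t - 2)) = eta q (t + 2) * eta q (t - 2)"
      using Fq.two_mem by (intro Fq.eta_mult GF_add GF_diff)
    then show "(1 - eta q (t + 2)) * (1 + eta q (t - 2)) * ?\<psi> (c * t) =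
      ?\<psi> (c * t) + eta q (t + (- 2)) * ?\<psi> (c * t) - eta q (t + 2) * ?\<psi> (c * t)
      - eta q ((t + 2) * (t - 2)) * ?\<psi> (c * t)" by (simp add: algebra_simps)
  qed
  also have "\<dots> = 0 + ?\<psi> (- (c * - 2)) * eta q c * ?G - ?\<psi> (- (c * 2)) * eta q c * ?G - (Kloost p m (c ^ 2) - 1)"
    unfolding sum_subtractf sum.distrib Fq.psi_scaled_sum[OF c] Kloost_eq[OF c]
    by (simp only: eta_shifted_sum[OF c Fq.two_mem] eta_shifted_sum[OF c GF_minus[OF Fq.two_mem]]) simp
  also have "\<dots> = 1 - Kloost p m (c ^ 2) + ?G * (eta q c * (?\<psi> (2 * c) - ?\<psi> (- (2 * c))))"
    by (simp add: algebra_simps)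
  also have "\<dots> = 1 - Kloost p m (c ^ 2) - 4 * Iconst p m * \<i> * complex_of_real (sin (2 * pi * real (Qfun p m c) / real p))"
    unfolding eta_sin[OF c] gauss_sum_Iconst by simp
  finally show ?thesis .
qed

text \<open>The nonsquares split according to z^N = w or z^N = -w. Inversion exchanges the halves,
  because 1 / w = -w, and preserves the summand.\<close>

lemma quarter_circle_sum:
  assumes c: "c \<in> GF m" and w: "w ^ 2 = -1"
  shows "(\<Sum>z | z ^ (2 * N) = -1. psi p m (c * (z + 1 / z))) =
    2 * (\<Sum>z | z ^ N = w. psi p m (c * (z + 1 / z)))"
proof -
  have w0: "w \<noteq> 0" using w by auto
  have winv: "1 / w = - w" 
  proof -
    have "w * - w = 1" using w by (simp add: power2_eq_square)
    then have "inverse w = - w" by (rule inverse_unique)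
    then show ?thesis by (simp only: inverse_eq_divide)
  qed
  have "w \<noteq> - w" using w0 two_nz by (simp add: eq_neg_iff_add_eq_0 mult_2[symmetric])
  have iff: "z ^ (2 * N) = -1 \<longleftrightarrow> z ^ N = w \<or> z ^ N = - w" for z
  proof -
    have sq: "z ^ (2 * N) = (z ^ N) ^ 2" by (simp only: power_mult[symmetric] mult.commute)
    have "z ^ (2 * N) = -1 \<longleftrightarrow> (z ^ N) ^ 2 = w ^ 2" by (subst sq) (simp only: w)
    also have "\<dots> \<longleftrightarrow> z ^ N = w \<or> z ^ N = - w" by (rule power2_eq_iff)
    finally show ?thesis .
  qed
  have un: "{z. z ^ (2 * N) = -1} = {z. z ^ N = w} \<union> {z. z ^ N = - w}"
    by (simp only: iff Collect_disj_eq)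
  have disj: "{z. z ^ N = w} \<inter> {z. z ^ N = - w} = {}"
  proof (rule equals0I)
    fix z assume "z \<in> {z. z ^ N = w} \<inter> {z. z ^ N = - w}"
    then have zw: "z ^ N = w" "z ^ N = - w" by blast+
    have "w = - w" by (rule trans[OF zw(1)[symmetric] zw(2)])
    then show False using \<open>w \<noteq> - w\<close> by contradiction
  qed
  have "(\<Sum>z | z ^ (2 * N) = -1. psi p m (c * (z + 1 / z))) =
    (\<Sum>z | z ^ N = w. psi p m (c * (z + 1 / z))) + (\<Sum>z | z ^ N = - w. psi p m (c * (z + 1 / z)))"
    unfolding un by (rule sum.union_disjoint[OF finite finite disj])
  also have "(\<Sum>z | z ^ N = - w. psi p m (c * (z + 1 / z))) = (\<Sum>z | z ^ N = w. psi p m (c * (z + 1 / z)))"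
  proof (rule sum.reindex_bij_witness[of _ "\<lambda>z. 1 / z" "\<lambda>z. 1 / z"])
    have "1 / - w = - (1 / w)" by simp
    also have "\<dots> = w" unfolding winv by simp
    finally have winv': "1 / - w = w" .
    show "1 / z \<in> {z. z ^ N = w}" if "z \<in> {z. z ^ N = - w}" for z
      using that by (simp only: power_divide mem_Collect_eq power_one winv')
    show "1 / z \<in> {z. z ^ N = - w}" if "z \<in> {z. z ^ N = w}" for z
      using that by (simp only: power_divide mem_Collect_eq power_one winv)
  qed (simp_all add: add.commute)
  finally show ?thesis by (simp only: mult_2)
qed

end

section \<open>Walsh transforms\<close>

context half_circle
begin

text \<open>The relative trace of lam x vanishes iff (lam x)^(q - 1) = -1, so the nonzero solutions
  form a single fibre of the (q - 1)-th power.\<close>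

lemma card_zeros_twisted_trace:
  assumes "lam \<noteq> 0"
  shows "card {x \<in> UNIV - {0}. lam * x + (lam * x) ^ q = 0} = q - 1"
    and "x \<noteq> 0 \<Longrightarrow> lam * x + (lam * x) ^ q = 0 \<longleftrightarrow> x ^ (q - 1) = - 1 / lam ^ (q - 1)"
    and "- 1 / lam ^ (q - 1) \<in> U"
proof -
  show *: "lam * x + (lam * x) ^ q = 0 \<longleftrightarrow> x ^ (q - 1) = - 1 / lam ^ (q - 1)" if x: "x \<noteq> 0" for x
  proof -
    have "(lam * x) ^ q = (lam * x) * (lam * x) ^ (q - 1)" by (subst q_Suc) simp
    then have "lam * x + (lam * x) ^ q = (lam * x) * (1 + (lam * x) ^ (q - 1))"
      by (simp only: distrib_left mult_1_right)
    also have "\<dots> = 0 \<longleftrightarrow> lam ^ (q - 1) * x ^ (q - 1) = - 1"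
      using assms x by (simp add: power_mult_distrib add_eq_0_iff)
    also have "\<dots> \<longleftrightarrow> x ^ (q - 1) = - 1 / lam ^ (q - 1)"
    proof -
      have "lam ^ (q - 1) \<noteq> 0" using assms by simp
      then show ?thesis by (metis nonzero_eq_divide_eq mult.commute)
    qed
    finally show ?thesis .
  qed
  show u: "- 1 / lam ^ (q - 1) \<in> U"
  proof -
    have "even (q + 1)" using q_N by simp
    moreover have "(lam ^ (q - 1)) ^ (q + 1) = 1" using power_q_1_in_U[OF assms] by (simp add: U_def)
    ultimately show ?thesis by (simp add: U_def power_divide)
  qed
  have "{x \<in> UNIV - {0}. lam * x + (lam * x) ^ q = 0} = {x. x ^ (q - 1) = - 1 / lam ^ (q - 1)}"
  proof (intro equalityI subsetI)
    fix x assume "x \<in> {x. x ^ (q - 1) = - 1 / lam ^ (q - 1)}"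
    moreover from this have "x \<noteq> 0" using U_nz[OF u] q_ge by (auto simp: power_0_left)
    ultimately show "x \<in> {x \<in> UNIV - {0}. lam * x + (lam * x) ^ q = 0}" using * by simp
  qed (use * in blast)
  then show "card {x \<in> UNIV - {0}. lam * x + (lam * x) ^ q = 0} = q - 1"
    using card_fiber[OF u] by simp
qed

text \<open>Dillon's setting: off 0, \<open>f\<close> is constant on the cosets of the
  multiplicative group of the field with q elements, and \<open>S\<close> takes one value per
  coset.\<close>

context
  fixes f g :: "'a \<Rightarrow> 'a" and S :: complex
  assumes f: "\<And>x. x \<noteq> 0 \<Longrightarrow> f x = g (x ^ (q - 1))" and f0: "f 0 = 0"
    and g: "\<And>u. u \<in> U \<Longrightarrow> g u \<in> GF 1"
    and S: "S = (\<Sum>u\<in>U. chi p (g u))"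
begin

lemma f_mem: "f x \<in> GF 1"
  using f f0 g power_q_1_in_U GF_0 by (cases "x = 0") auto

lemma sum_nonzero: "(\<Sum>x\<in>UNIV - {0}. chi p (f x)) = of_nat (q - 1) * S"
proof -
  have "(\<Sum>x\<in>UNIV - {0}. chi p (f x)) = (\<Sum>x\<in>UNIV - {0}. chi p (g (x ^ (q - 1))))"
    by (rule sum.cong) (auto simp: f)
  also have "\<dots> = (\<Sum>u\<in>U. of_nat (card {x\<in>UNIV - {0}. x ^ (q - 1) = u}) * chi p (g u))"
    by (rule sum_image_card) (auto intro: power_q_1_in_U)
  also have "\<dots> = (\<Sum>u\<in>U. of_nat (q - 1) * chi p (g u))"
  proof (rule sum.cong[OF refl])
    fix u assume u: "u \<in> U"
    have "{x\<in>UNIV - {0}. x ^ (q - 1) = u} = {x. x ^ (q - 1) = u}"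
      using U_nz[OF u] q_ge by (auto simp: power_0_left)
    then show "of_nat (card {x\<in>UNIV - {0}. x ^ (q - 1) = u}) * chi p (g u) = of_nat (q - 1) * chi p (g u)"
      using card_fiber[OF u] by simp
  qed
  finally show ?thesis by (simp add: S sum_distrib_left)
qed

lemma walsh_split:
  "walsh p (2 * m) f lam = 1 + (\<Sum>x\<in>UNIV - {0}. chi p (f x) * psi p m (- (lam * x + (lam * x) ^ q)))"
proof -
  have "walsh p (2 * m) f lam = (\<Sum>x\<in>UNIV. chi p (f x - tr p 1 (2 * m) (lam * x)))"
    by (simp add: walsh_def chi_def)
  also have "\<dots> = chi p (f 0 - tr p 1 (2 * m) (lam * 0)) + (\<Sum>x\<in>UNIV - {0}. chi p (f x - tr p 1 (2 * m) (lam * x)))"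
    by (subst sum.remove[of _ 0]) auto
  also have "(\<Sum>x\<in>UNIV - {0}. chi p (f x - tr p 1 (2 * m) (lam * x))) =
      (\<Sum>x\<in>UNIV - {0}. chi p (f x) * psi p m (- (lam * x + (lam * x) ^ q)))"
  proof (rule sum.cong[OF refl])
    fix x
    have "chi p (f x - tr p 1 (2 * m) (lam * x)) = chi p (f x + tr p 1 m (- (lam * x + (lam * x) ^ q)))"
      by (simp only: tr_2m tr_minus diff_conv_add_uminus)
    also have "\<dots> = chi p (f x) * psi p m (- (lam * x + (lam * x) ^ q))"
      unfolding psi_def by (intro chi_add f_mem tr_mem GF_minus trace_mem)
    finally show "chi p (f x - tr p 1 (2 * m) (lam * x)) = chi p (f x) * psi p m (- (lam * x + (lam * x) ^ q))" .
  qed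
  finally show ?thesis by (simp add: f0 tr_0 chi_0)
qed

lemma walsh_0: "walsh p (2 * m) f 0 = 1 + of_nat (q - 1) * S"
  using q_ge unfolding walsh_split by (simp add: Fq.psi_0 sum_nonzero power_0_left)

text \<open>Scaling x by a nonzero y in the field with q elements does not change \<open>f\<close>,
  so the sum over nonzero x equals its average over y. Orthogonality in y leaves q times the single
  fibre where \<open>D\<close> vanishes, minus the full sum.\<close>

lemma walsh_nonzero:
  assumes lam: "lam \<noteq> 0"
  shows "walsh p (2 * m) f lam = 1 - S + of_nat q * chi p (g (- 1 / lam ^ (q - 1)))"
proof -
  define D where "D x = lam * x + (lam * x) ^ q" for x
  define u where "u = - 1 / lam ^ (q - 1)"
  define W where "W = (\<Sum>x\<in>UNIV - {0}. chi p (f x) * psi p m (- D x))"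
  have Dm: "D x \<in> GF m" for x unfolding D_def by (rule trace_mem)
  have inner: "(\<Sum>y\<in>GF m - {0}. psi p m (- (y * D x))) = (if D x = 0 then of_nat q else 0) - 1" for x
  proof (cases "D x = 0")
    case True
    then show ?thesis using Fq.card_F q_ge by (simp add: Fq.psi_0 card_Diff_singleton GF_0 of_nat_diff)
  next
    case False
    have "(\<Sum>y\<in>GF m. psi p m (- D x * y)) = 0"
      using False Dm by (intro Fq.psi_scaled_sum GF_minus) auto
    then have "psi p m (- D x * 0) + (\<Sum>y\<in>GF m - {0}. psi p m (- D x * y)) = 0"
      by (subst (asm) sum.remove[of _ 0]) (auto simp: GF_0)
    then show ?thesis using False by (simp add: Fq.psi_0 add_eq_0_iff mult.commute)
  qed
  have resc: "W = (\<Sum>x\<in>UNIV - {0}. chi p (f x) * psi p m (- (y * D x)))" if y: "y \<in> GF m - {0}" for y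
    unfolding W_def
  proof (rule sum.reindex_bij_witness[of _ "\<lambda>x. y * x" "\<lambda>x. x / y"])
    fix x :: 'a assume x: "x \<in> UNIV - {0}"
    have y1: "y ^ q = y" "y ^ (q - 1) = 1" using y GFm_iff GFm_nz_iff by auto
    have "y * D (x / y) = D x" using y y1 by (simp add: D_def power_mult_distrib power_divide distrib_left)
    moreover have "f (x / y) = f x" using x y y1 by (simp add: f power_divide)
    ultimately show "chi p (f (x / y)) * psi p m (- (y * D (x / y))) = chi p (f x) * psi p m (- D x)" by simp
  qed (use y in auto)
  have cm: "card (GF m - {0}) = q - 1" using Fq.card_F by (simp add: card_Diff_singleton GF_0)
  have "of_nat (q - 1) * W = (\<Sum>y\<in>GF m - {0}. \<Sum>x\<in>UNIV - {0}. chi p (f x) * psi p m (- (y * D x)))"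
    using cm by (simp add: resc[symmetric])
  also have "\<dots> = (\<Sum>x\<in>UNIV - {0}. chi p (f x) * ((if D x = 0 then of_nat q else 0) - 1))"
    by (subst sum.swap) (simp add: sum_distrib_left[symmetric] inner)
  also have "\<dots> = (\<Sum>x\<in>UNIV - {0}. (if D x = 0 then of_nat q * chi p (g u) else 0)) - of_nat (q - 1) * S"
    unfolding sum_nonzero[symmetric] sum_subtractf[symmetric]
    using card_zeros_twisted_trace(2)[OF lam] by (intro sum.cong) (auto simp: D_def u_def f algebra_simps)
  also have "(\<Sum>x\<in>UNIV - {0}. (if D x = 0 then of_nat q * chi p (g u) else 0)) = of_nat (q - 1) * (of_nat q * chi p (g u))"
    using card_zeros_twisted_trace(1)[OF lam] by (simp add: sum.If_cases D_def Int_def)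
  finally have "of_nat (q - 1) * W = of_nat (q - 1) * (of_nat q * chi p (g u) - S)"
    by (simp add: right_diff_distrib)
  moreover have "(of_nat (q - 1) :: complex) \<noteq> 0" using q_ge by simp
  ultimately have "W = of_nat q * chi p (g u) - S" by (metis mult_left_cancel)
  then show ?thesis unfolding walsh_split u_def W_def D_def by simp
qed

lemma regular_bent_iff: "regular_bent p (2 * m) f \<longleftrightarrow> S = 1"
proof -
  have sq: "complex_of_real (sqrt (real p ^ (2 * m))) = of_nat q"
  proof -
    have "sqrt (real p ^ (2 * m)) = sqrt ((real q) ^ 2)"
      unfolding q_def of_nat_power power_mult[symmetric] by (simp only: mult.commute)
    then show ?thesis by simp
  qed
  have rb: "regular_bent p (2 * m) f \<longleftrightarrow> (\<exists>h :: 'a \<Rightarrow> 'a. (\<forall>y. h y \<in> GF 1) \<and>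
      (\<forall>lam. walsh p (2 * m) f lam = of_nat q * chi p (h lam)))"
    unfolding regular_bent_def sq chi_def ..
  show ?thesis
  proof
    assume S1: "S = 1"
    define h where "h lam = (if lam = 0 then 0 else g (- 1 / lam ^ (q - 1)))" for lam
    have "h y \<in> GF 1" for y
      using g[OF card_zeros_twisted_trace(3)] by (simp add: h_def GF_0)
    moreover have "walsh p (2 * m) f lam = of_nat q * chi p (h lam)" for lam
    proof (cases "lam = 0")
      case True
      have "1 + of_nat (q - 1) * 1 = (of_nat (Suc (q - 1)) :: complex)" by simp
      also have "\<dots> = of_nat q" by (simp only: q_Suc[symmetric])
      finally show ?thesis unfolding True walsh_0 S1 by (simp add: h_def chi_0)
    next
      case False
      then show ?thesis unfolding walsh_nonzero[OF False] S1 by (simp add: h_def)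
    qed
    ultimately show "regular_bent p (2 * m) f" unfolding rb by blast
  next
    assume "regular_bent p (2 * m) f"
    then obtain h :: "'a \<Rightarrow> 'a" where h: "\<And>lam. walsh p (2 * m) f lam = of_nat q * chi p (h lam)"
      unfolding rb by blast
    define z0 where "z0 = chi p (h 0)"
    define z1 where "z1 = chi p (h 1)"
    define w where "w = chi p (g (-1))"
    have "of_nat (q - 1) = (of_nat q - 1 :: complex)" using q_ge by (simp add: of_nat_diff)
    then have e0: "1 + (of_nat q - 1) * S = of_nat q * z0"
      using trans[OF walsh_0[symmetric] h[of 0]] by (simp only: z0_def)
    have e1: "1 - S + of_nat q * w = of_nat q * z1"
      using trans[OF walsh_nonzero[OF one_neq_zero, symmetric] h[of 1]]
      by (simp add: z1_def w_def)
    have S1: "1 - S = of_nat q * z1 - of_nat q * w" unfolding e1[symmetric] by simp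
    \<comment> \<open>Eliminating \<open>S\<close> from the Walsh values at 0 and 1, then cancelling
      q, leaves a relation among roots of unity alone.\<close>
    have "of_nat q * (1 - z0) = of_nat q - (1 + (of_nat q - 1) * S)"
      unfolding e0 by (simp add: right_diff_distrib)
    also have "\<dots> = (of_nat q - 1) * (1 - S)" by (simp add: algebra_simps)
    also have "\<dots> = of_nat q * ((of_nat q - 1) * (z1 - w))" unfolding S1 by (simp add: algebra_simps)
    finally have "1 - z0 = (of_nat q - 1) * (z1 - w)" using q_ge by (simp only: mult_left_cancel of_nat_eq_0_iff)
    then have eq: "1 - z0 = complex_of_real (real q - 1) * (z1 - w)" by simp
    have "p \<le> q" unfolding q_def using p_pos m_pos by (intro self_le_power) auto
    then have "z1 = w"
      by (rule root_of_unity_rigidity[OF odd_p p_pos(2) _ _ _ _ eq])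
        (simp_all only: z0_def z1_def w_def chi_root)
    then have "1 - S = 0" using S1 by simp
    then show "S = 1" by simp
  qed
qed

end

end

section \<open>Factorisation of the circle sum\<close>

context half_circle
begin

definition V :: "'a set" where "V = {v. v ^ N = 1}"
definition \<mu>\<^sub>4 :: "'a set" where "\<mu>\<^sub>4 = {w. w ^ 4 = 1}"

lemma mu4_eq: "\<mu>\<^sub>4 = {1, -1, im, - im}"
proof -
  have "w ^ 4 = 1 \<longleftrightarrow> w = 1 \<or> w = -1 \<or> w = im \<or> w = - im" for w
  proof -
    have "w ^ 4 = (w ^ 2) ^ 2" by (simp add: power_mult[symmetric])
    then have "w ^ 4 = 1 \<longleftrightarrow> w ^ 2 = 1 \<or> w ^ 2 = - 1" by (simp only: power2_eq_1_iff)
    moreover have "w ^ 2 = 1 \<longleftrightarrow> w = 1 \<or> w = - 1" by (rule power2_eq_1_iff)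
    moreover have "w ^ 2 = - 1 \<longleftrightarrow> w = im \<or> w = - im" unfolding im_square[symmetric] by (rule power2_eq_iff)
    ultimately show ?thesis by blast
  qed
  then show ?thesis unfolding \<mu>\<^sub>4_def by blast
qed

context
  fixes l :: int
  assumes coprime_l: "coprime l (int N)" and four_dvd: "4 dvd l"
begin

lemma odd_N: "odd N"
proof
  assume "even N"
  then have "2 dvd int N" by simp
  moreover have "2 dvd l" using four_dvd by (rule dvd_trans[rotated]) simp
  ultimately show False using coprime_l by (metis coprime_common_divisor odd_one)
qed

text \<open>The exponent \<open>N * N\<close> is 1 modulo 4 and 0 modulo \<open>N\<close>, so its
  power map projects \<open>U\<close> onto \<open>\<mu>\<^sub>4\<close> along
  \<open>V\<close>.\<close>

lemma N_square_mod: "\<exists>j. N * N = 4 * j + 1"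
proof -
  obtain k where "N = 2 * k + 1" using odd_N by (elim oddE)
  then have "N * N = 4 * (k * k + k) + 1" by (simp add: algebra_simps)
  then show ?thesis by blast
qed

lemma mu4_power: "w \<in> \<mu>\<^sub>4 \<Longrightarrow> w ^ (N * N) = w"
proof -
  assume w: "w \<in> \<mu>\<^sub>4"
  obtain j where "N * N = 4 * j + 1" using N_square_mod by blast
  then have "w ^ (N * N) = w ^ (4 * j + 1)" by (rule arg_cong)
  then show ?thesis using w by (simp add: \<mu>\<^sub>4_def power_add power_mult)
qed

lemma mu4_powi: "w \<in> \<mu>\<^sub>4 \<Longrightarrow> w powi l = 1"
proof -
  assume w: "w \<in> \<mu>\<^sub>4"
  obtain k where k: "l = 4 * k" using four_dvd by auto
  have "w powi 4 = 1" using w by (simp add: \<mu>\<^sub>4_def)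
  then show ?thesis unfolding k power_int_mult by simp
qed

lemma mu4_nz: "w \<in> \<mu>\<^sub>4 \<Longrightarrow> w \<noteq> 0" and V_nz: "v \<in> V \<Longrightarrow> v \<noteq> 0"
  using N_pos by (auto simp: \<mu>\<^sub>4_def V_def power_0_left)

lemma powi_V: "v \<in> V \<Longrightarrow> v powi (i * int N) = 1"
  by (subst mult.commute) (simp add: power_int_mult V_def)

lemma V_powi_eq_1: "v \<in> V \<Longrightarrow> v powi l = 1 \<Longrightarrow> v = 1"
proof -
  assume v: "v \<in> V" "v powi l = 1"
  obtain s t where st: "s * l + t * int N = 1" using bezout_int[of l "int N"] coprime_l by (auto simp: coprime_iff_gcd_eq_1)
  have "v = v powi (s * l + t * int N)" by (simp add: st)
  also have "\<dots> = v powi (s * l) * v powi (t * int N)" using V_nz[OF v(1)] by (simp add: power_int_add)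
  also have "v powi (s * l) = 1" by (subst mult.commute) (simp add: power_int_mult v(2))
  finally show ?thesis by (simp add: powi_V[OF v(1)])
qed

lemma bij_powi_V: "bij_betw (\<lambda>v. v powi l) V V"
proof -
  have "inj_on (\<lambda>v. v powi l) V"
  proof (rule inj_onI)
    fix v w assume vw: "v \<in> V" "w \<in> V" "v powi l = w powi l"
    have "v / w \<in> V" using vw by (simp add: V_def power_divide)
    moreover have "(v / w) powi l = 1"
      using vw V_nz by (simp add: power_int_divide_distrib)
    ultimately have "v / w = 1" by (rule V_powi_eq_1)
    then show "v = w" using V_nz vw by simp
  qed
  moreover have "v powi l \<in> V" if "v \<in> V" for v
    using powi_V[OF that, of l] by (simp add: V_def power_int_mult)
  ultimately show ?thesis
    by (simp add: bij_betw_def card_image card_subset_eq image_subset_iff)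
qed

lemma bij_V_mu4: "bij_betw (\<lambda>(v, w). v * w) (V \<times> \<mu>\<^sub>4) U"
proof (rule bij_betw_byWitness[where f' = "\<lambda>u. (u / u ^ (N * N), u ^ (N * N))"])
  have vN: "v ^ (N * N) = 1" if "v \<in> V" for v using that by (simp add: V_def power_mult)
  show "\<forall>a\<in>V \<times> \<mu>\<^sub>4. (\<lambda>u. (u / u ^ (N * N), u ^ (N * N))) ((\<lambda>(v, w). v * w) a) = a"
    using mu4_nz by (auto simp: power_mult_distrib vN mu4_power)
  show "\<forall>u\<in>U. (\<lambda>(v, w). v * w) (u / u ^ (N * N), u ^ (N * N)) = u" using U_nz by auto
  show "(\<lambda>(v, w). v * w) ` (V \<times> \<mu>\<^sub>4) \<subseteq> U"
  proof clarify
    fix v w assume "v \<in> V" "w \<in> \<mu>\<^sub>4"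
    then have "(v ^ N) ^ 4 * (w ^ 4) ^ N = 1" by (simp add: V_def \<mu>\<^sub>4_def)
    then have "v ^ (4 * N) * w ^ (4 * N) = 1" by (simp add: power_mult[symmetric] mult.commute)
    then show "v * w \<in> U" by (simp only: U_def mem_Collect_eq q_N power_mult_distrib)
  qed
  show "(\<lambda>u. (u / u ^ (N * N), u ^ (N * N))) ` U \<subseteq> V \<times> \<mu>\<^sub>4"
  proof (rule image_subsetI)
    fix u assume u: "u \<in> U"
    have u4: "(u ^ N) ^ 4 = 1"
      using u unfolding U_def mem_Collect_eq q_N by (simp add: power_mult[symmetric] mult.commute)
    then have uN: "u ^ N \<in> \<mu>\<^sub>4" by (simp add: \<mu>\<^sub>4_def)
    have "(u ^ (N * N)) ^ 4 = ((u ^ N) ^ 4) ^ N" by (simp add: power_mult[symmetric] mult_ac)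
    then have "u ^ (N * N) \<in> \<mu>\<^sub>4" using u4 by (simp add: \<mu>\<^sub>4_def)
    moreover have "(u ^ (N * N)) ^ N = u ^ N"
      using mu4_power[OF uN] by (simp add: power_mult[symmetric] mult_ac)
    then have "u / u ^ (N * N) \<in> V" using U_nz[OF u] by (simp add: V_def power_divide)
    ultimately show "(u / u ^ (N * N), u ^ (N * N)) \<in> V \<times> \<mu>\<^sub>4" by simp
  qed
qed

text \<open>For u = v w the exponent \<open>l\<close> kills w and \<open>N\<close> kills v. What
  remains is a reparametrisation: \<open>l\<close> permutes \<open>V\<close>, and the
  \<open>N\<close>-th power is an involution of \<open>\<mu>\<^sub>4\<close>.\<close>

lemma sum_U_factor:
  fixes \<phi>\<^sub>1 \<phi>\<^sub>2 :: "'a \<Rightarrow> complex"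
  shows "(\<Sum>u\<in>U. \<phi>\<^sub>1 (u powi l) * \<phi>\<^sub>2 (u ^ N)) = (\<Sum>v\<in>V. \<phi>\<^sub>1 v) * (\<Sum>w\<in>\<mu>\<^sub>4. \<phi>\<^sub>2 w)"
proof -
  have "(\<Sum>u\<in>U. \<phi>\<^sub>1 (u powi l) * \<phi>\<^sub>2 (u ^ N)) =
      (\<Sum>(v, w)\<in>V \<times> \<mu>\<^sub>4. \<phi>\<^sub>1 ((v * w) powi l) * \<phi>\<^sub>2 ((v * w) ^ N))"
    by (subst sum.reindex_bij_betw[OF bij_V_mu4, symmetric]) (simp add: case_prod_beta)
  also have "\<dots> = (\<Sum>(v, w)\<in>V \<times> \<mu>\<^sub>4. \<phi>\<^sub>1 (v powi l) * \<phi>\<^sub>2 (w ^ N))"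
    by (rule sum.cong) (auto simp: power_int_mult_distrib mu4_powi power_mult_distrib V_def)
  also have "\<dots> = (\<Sum>v\<in>V. \<phi>\<^sub>1 (v powi l)) * (\<Sum>w\<in>\<mu>\<^sub>4. \<phi>\<^sub>2 (w ^ N))"
    by (simp add: sum_product sum.cartesian_product)
  also have "(\<Sum>v\<in>V. \<phi>\<^sub>1 (v powi l)) = (\<Sum>v\<in>V. \<phi>\<^sub>1 v)"
    by (rule sum.reindex_bij_betw[OF bij_powi_V])
  also have "(\<Sum>w\<in>\<mu>\<^sub>4. \<phi>\<^sub>2 (w ^ N)) = (\<Sum>w\<in>\<mu>\<^sub>4. \<phi>\<^sub>2 w)"
  proof (rule sum.reindex_bij_witness[of _ "\<lambda>w. w ^ N" "\<lambda>w. w ^ N"])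
    have "w ^ N \<in> \<mu>\<^sub>4" if "w \<in> \<mu>\<^sub>4" for w
    proof -
      have "(w ^ N) ^ 4 = (w ^ 4) ^ N" by (simp add: power_mult[symmetric] mult.commute)
      then show ?thesis using that by (simp add: \<mu>\<^sub>4_def)
    qed
    then show "w \<in> \<mu>\<^sub>4 \<Longrightarrow> w ^ N \<in> \<mu>\<^sub>4" "w \<in> \<mu>\<^sub>4 \<Longrightarrow> w ^ N \<in> \<mu>\<^sub>4" for w by blast+
  qed (simp_all add: power_mult[symmetric] mu4_power)
  finally show ?thesis .
qed

end

text \<open>The coset of \<open>V\<close> through \<open>\<xi> ^ k\<close> is the set of z with z^N
  = w, and w is a square root of -1 because \<open>k\<close> is odd; so
  \<open>quarter_circle_sum\<close> applies.\<close>

lemma sum_V: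
  assumes c: "c \<in> GF m" and k: "odd k"
  shows "4 * (\<Sum>v\<in>V. chi p (tr p 1 (2 * m) (c * \<xi> ^ k * v))) =
    2 * (\<Sum>z | z ^ (2 * N) = -1. psi p m (c * (z + 1 / z)))"
proof -
  define w where "w = \<xi> ^ (k * N)"
  have w2: "w ^ 2 = -1"
  proof -
    have "w ^ 2 = (im ^ 2) ^ k" by (simp add: w_def im_def power_mult[symmetric] mult_ac)
    then show ?thesis using k by (simp add: im_square)
  qed
  have xi: "\<xi> \<in> U" using xi_U by (simp add: U_def q_def)
  have xi0: "\<xi> \<noteq> 0" using U_nz[OF xi] .
  have "(\<Sum>v\<in>V. chi p (tr p 1 (2 * m) (c * \<xi> ^ k * v))) = (\<Sum>z | z ^ N = w. psi p m (c * (z + 1 / z)))"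
  proof (rule sum.reindex_bij_witness[of _ "\<lambda>z. z / \<xi> ^ k" "\<lambda>v. \<xi> ^ k * v"])
    fix v assume v: "v \<in> V"
    then show zN: "\<xi> ^ k * v \<in> {z. z ^ N = w}"
      by (simp add: V_def w_def power_mult_distrib power_mult)
    have "(\<xi> ^ k * v) ^ (2 * N) = ((\<xi> ^ k * v) ^ N) ^ 2" by (simp only: power_mult[symmetric] mult.commute)
    then have "(\<xi> ^ k * v) ^ (2 * N) = -1" using zN w2 by simp
    then have z: "\<xi> ^ k * v \<in> U" by (rule half_in_U)
    have "(c * (\<xi> ^ k * v)) ^ q = c * (1 / (\<xi> ^ k * v))"
      using c U_conj[OF z] by (simp only: power_mult_distrib[of c] GFm_iff)
    then have "tr p 1 (2 * m) (c * \<xi> ^ k * v) = tr p 1 m (c * (\<xi> ^ k * v + 1 / (\<xi> ^ k * v)))"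
      unfolding tr_2m mult.assoc distrib_left by (simp only:)
    then show "psi p m (c * (\<xi> ^ k * v + 1 / (\<xi> ^ k * v))) = chi p (tr p 1 (2 * m) (c * \<xi> ^ k * v))"
      by (simp only: psi_def)
  next
    fix z assume "z \<in> {z. z ^ N = w}"
    then show "z / \<xi> ^ k \<in> V" using xi0 by (simp add: V_def w_def power_divide power_mult)
  qed (use xi0 in auto)
  then show ?thesis by (simp only: quarter_circle_sum[OF c w2]) simp
qed

lemma sum_mu4:
  assumes b: "b \<in> GF 2"
  shows "(\<Sum>w\<in>\<mu>\<^sub>4. chi p (tr p 1 2 (b * w))) = 2 * complex_of_real
      (cos (2 * pi * real (fp_val p (tr p 1 2 b)) / real p) +
       cos (2 * pi * real (fp_val p (tr p 1 2 (b * im))) / real p))"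
    and "(\<Sum>w\<in>\<mu>\<^sub>4. chi p (tr p 1 2 (b * w))) \<noteq> 0"
proof -
  have im4: "im ^ 4 = 1" using mu4_eq by (auto simp: \<mu>\<^sub>4_def)
  \<comment> \<open>\<open>p ^ 2\<close> is 1 modulo 4, so fourth roots of unity are fixed by the
    power with this exponent.\<close>
  have "im \<in> GF 2"
  proof -
    obtain j where "p = 4 * j + 3" using p_mod by (metis mult_div_mod_eq)
    then have "p ^ 2 = 4 * (4 * j * j + 6 * j + 2) + 1" by (simp add: power2_eq_square algebra_simps)
    then have "im ^ (p ^ 2) = im" by (simp only: power_add power_mult im4 power_one) simp
    then show ?thesis by (simp add: GF_iff)
  qed
  then have mem: "tr p 1 2 b \<in> GF 1" "tr p 1 2 (b * im) \<in> GF 1"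
    using b by (auto intro!: tr_mem GF_mult)
  define x where "x = chi p (tr p 1 2 b)"
  define y where "y = chi p (tr p 1 2 (b * im))"
  have im1: "im \<noteq> 1" "im \<noteq> - 1" using im_square Fq.one_neq_minus_one by auto
  have ne: "im \<noteq> - im" using im_square two_nz by (auto simp: eq_neg_iff_add_eq_0 mult_2[symmetric])
  have im2: "1 \<noteq> - im" "- 1 \<noteq> - im" using im1 by (auto simp: minus_equation_iff)
  have "(\<Sum>w\<in>\<mu>\<^sub>4. chi p (tr p 1 2 (b * w))) = x + (chi p (tr p 1 2 (b * - 1)) + (y + chi p (tr p 1 2 (b * - im))))"
    unfolding mu4_eq using im1[symmetric] im2 ne Fq.one_neq_minus_one
    by (subst sum.insert, simp, simp)+ (simp add: x_def y_def)
  also have "b * - 1 = - b" by simp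
  also have "b * - im = - (b * im)" by simp
  finally have S: "(\<Sum>w\<in>\<mu>\<^sub>4. chi p (tr p 1 2 (b * w))) = x + cnj x + (y + cnj y)"
    by (simp only: tr_minus chi_minus[OF mem(1)] chi_minus[OF mem(2)] x_def y_def add.assoc)
  then show "(\<Sum>w\<in>\<mu>\<^sub>4. chi p (tr p 1 2 (b * w))) = 2 * complex_of_real
      (cos (2 * pi * real (fp_val p (tr p 1 2 b)) / real p) +
       cos (2 * pi * real (fp_val p (tr p 1 2 (b * im))) / real p))"
    unfolding Re_chi[symmetric] by (simp only: complex_add_cnj x_def y_def) simp
  text \<open>If the sum vanished, \<open>(x + y) (1 + 1 / (x y)) = 0\<close>, so a product of p-th roots of unity would be \<open>-1\<close>.\<close>
  show "(\<Sum>w\<in>\<mu>\<^sub>4. chi p (tr p 1 2 (b * w))) \<noteq> 0"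
  proof
    assume "(\<Sum>w\<in>\<mu>\<^sub>4. chi p (tr p 1 2 (b * w))) = 0"
    then have 0: "x + cnj x + (y + cnj y) = 0" using S by simp
    have n: "x * cnj x = 1" "y * cnj y = 1" by (simp_all add: x_def y_def chi_norm)
    have "(x + y) * (1 + x * y) = x * y * (x + y) + x + y" by (simp add: algebra_simps)
    also have "\<dots> = x * y * (x + cnj x + (y + cnj y)) + x * (1 - y * cnj y) + y * (1 - x * cnj x)"
      by (simp add: algebra_simps)
    also have "\<dots> = 0" by (simp add: 0 n)
    finally have "x + y = 0 \<or> x * y + 1 = 0" by (simp only: mult_eq_0_iff add.commute)
    then have "x = - y \<or> x * y = - 1" by (simp only: eq_neg_iff_add_eq_0)
    moreover have xp: "x ^ p = 1" "y ^ p = 1" by (simp_all only: x_def y_def chi_root)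
    moreover have "(- y) ^ p = - 1" using xp odd_p by (simp add: power_minus_odd)
    moreover have "(x * y) ^ p = 1" by (simp add: power_mult_distrib xp)
    moreover have "(- 1 :: complex) ^ p = - 1" using odd_p by simp
    ultimately show False by auto
  qed
qed

end

theorem theorem6:
  fixes p m n k :: nat and l :: int and b abar \<xi> a :: "'a::{field,finite}"
    and f :: "'a \<Rightarrow> 'a"
  assumes "prime p" and "odd p" and "m > 0" and "p ^ m mod 4 = 3" and "n = 2 * m"
    and "card (UNIV :: 'a set) = p ^ n"
    and "\<xi> ^ (p ^ m + 1) = 1"
    and "\<forall>x::'a. x ^ (p ^ m + 1) = 1 \<longrightarrow> (\<exists>j::nat. x = \<xi> ^ j)"
    and "b \<in> subfield_pk p 2" and "b \<noteq> 0"
    and "gcd l (int ((p ^ m + 1) div 4)) = 1" and "4 dvd l"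
    and "k > 0" and "k mod 4 = 1 \<or> k mod 4 = 3"
    and "abar \<in> subfield_pk p m" and "abar \<noteq> 0"
    and "a = abar * \<xi> ^ k"
    and "\<And>x. f x = tr p 1 n (a * x powi (l * (int (p ^ m) - 1)))
                   + tr p 1 2 (b * x ^ ((p ^ n - 1) div 4))"
  shows "regular_bent p n f \<longleftrightarrow>
    Kloost p m (abar ^ 2) =
      1 - 4 * Iconst p m * \<i> * complex_of_real (sin (2 * pi * real (Qfun p m abar) / real p))
      - 2 / complex_of_real (cos (2 * pi * real (fp_val p (tr p 1 2 b)) / real p)
           + cos (2 * pi * real (fp_val p (tr p 1 2 (b * \<xi> ^ ((p ^ m + 1) div 4)))) / real p))"
proof -
  \<comment> \<open>The square of an odd number is 1 modulo 4, so an even \<open>m\<close> would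
    contradict the congruence for \<open>p ^ m\<close>.\<close>
  have m_odd: "odd m"
  proof
    assume "even m"
    then obtain j where j: "m = 2 * j" by auto
    obtain i where i: "p = 2 * i + 1" using \<open>odd p\<close> by (elim oddE)
    have "p ^ 2 = 4 * (i * i + i) + 1" by (simp add: i power2_eq_square algebra_simps)
    then have "p ^ 2 mod 4 = 1" by (simp only: mod_mult_self4) simp
    then have "p ^ m mod 4 = 1" unfolding j power_mult by (metis power_mod power_one one_mod_numeral[simplified] mod_less one_less_numeral_iff semiring_norm(76))
    then show False using assms(4) by simp
  qed
  have p_mod: "p mod 4 = 3"
  proof (rule ccontr)
    assume "p mod 4 \<noteq> 3"
    then have "p mod 4 = 1" using \<open>odd p\<close> by presburger
    then have "p ^ m mod 4 = 1" by (metis power_mod power_one mod_less one_less_numeral_iff semiring_norm(76))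
    then show False using assms(4) by simp
  qed
  interpret half_circle p m "TYPE('a)" \<xi>
    using assms m_odd p_mod by unfold_locales auto
  have N: "(p ^ m + 1) div 4 = N" by (simp add: N_def q_def)
  have im: "\<xi> ^ ((p ^ m + 1) div 4) = im" by (simp add: im_def N)
  have odd_k: "odd k" using assms(14) by presburger
  have l: "coprime l (int N)" "4 dvd l" using assms(11,12) N by (simp_all add: coprime_iff_gcd_eq_1)
  \<comment> \<open>This makes the second trace, too, a function of
    \<open>x ^ (q - 1)\<close>.\<close>
  have exponent: "(p ^ n - 1) div 4 = (q - 1) * N"
  proof -
    have "p ^ n - 1 = (q - 1) * (4 * N)"
      using card_UNIV_q by (simp only: card_UNIV assms(5) q_N)
    then show ?thesis by simp
  qed
  define g where "g u = tr p 1 n (a * u powi l) + tr p 1 2 (b * u ^ N)" for u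
  have f_g: "f x = g (x ^ (q - 1))" if "x \<noteq> 0" for x
  proof -
    have "int (p ^ m) - 1 = int (q - 1)" using q_ge by (simp add: q_def of_nat_diff)
    then have "x powi (l * (int (p ^ m) - 1)) = (x ^ (q - 1)) powi l"
      by (subst mult.commute) (simp add: power_int_mult)
    moreover have "x ^ ((p ^ n - 1) div 4) = (x ^ (q - 1)) ^ N" by (simp add: exponent power_mult)
    ultimately show ?thesis unfolding assms(18) g_def by (simp only:)
  qed
  have f_0: "f 0 = 0"
  proof -
    have e: "(q - 1) * N > 0" using q_ge N_pos by simp
    have "tr p 1 n (a * 0 powi (l * (int (p ^ m) - 1))) = 0"
    \<comment> \<open>\<open>0 powi 0\<close> is 1, so \<open>l = 0\<close> is special. Coprimality
      then forces \<open>N = 1\<close>, hence \<open>im = \<xi>\<close>; conjugation negates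
      \<open>a\<close>, and its trace vanishes.\<close>
    proof (cases "l = 0")
      case False
      moreover have "int (p ^ m) - 1 \<noteq> 0" using q_ge unfolding q_def by linarith
      ultimately have "l * (int (p ^ m) - 1) \<noteq> 0" by (simp only: mult_eq_0_iff simp_thms)
      then show ?thesis by (simp add: power_int_0_left tr_0)
    next
      case True
      then have "N = 1" using l(1) by simp
      then have "im = \<xi>" by (simp add: im_def)
      then have "(\<xi> ^ k) ^ q = - (\<xi> ^ k)"
        using im_conj odd_k by (metis power_commutes power_minus_odd power_mult mult.commute)
      then have "a + a ^ q = 0"
        using assms(15,17) by (simp add: power_mult_distrib GFm_iff)
      then show ?thesis using True by (simp add: assms(5) tr_2m tr_0)
    qed
    then show ?thesis using e unfolding assms(18) exponent by (simp add: tr_0 power_0_left)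
  qed
  have mem_n: "tr p 1 n y \<in> GF 1" for y :: 'a
    unfolding assms(5) by (rule tr_mem) (simp add: GF_2m)
  have GF2: "w \<in> GF 2" if "w \<in> \<mu>\<^sub>4" for w
  proof -
    obtain j where "p = 4 * j + 3" using p_mod by (metis mult_div_mod_eq)
    then have "p ^ 2 = 4 * (4 * j * j + 6 * j + 2) + 1" by (simp add: power2_eq_square algebra_simps)
    then have "w ^ (p ^ 2) = w" using that by (simp only: \<mu>\<^sub>4_def mem_Collect_eq power_add power_mult power_one) simp
    then show ?thesis by (simp add: GF_iff)
  qed
  have uN: "u ^ N \<in> \<mu>\<^sub>4" if "u \<in> U" for u
    using that unfolding U_def mem_Collect_eq q_N by (simp add: \<mu>\<^sub>4_def power_mult[symmetric] mult.commute)
  have mem_2: "tr p 1 2 (b * u ^ N) \<in> GF 1" if "u \<in> U" for u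
    using assms(9) GF2[OF uN[OF that]] by (intro tr_mem GF_mult)
  define C where "C = complex_of_real (cos (2 * pi * real (fp_val p (tr p 1 2 b)) / real p)
           + cos (2 * pi * real (fp_val p (tr p 1 2 (b * im))) / real p))"
  define X where "X = 1 - Kloost p m (abar ^ 2)
    - 4 * Iconst p m * \<i> * complex_of_real (sin (2 * pi * real (Qfun p m abar) / real p))"
  define S where "S = (\<Sum>u\<in>U. chi p (g u))"
  have "S = (\<Sum>u\<in>U. chi p (tr p 1 n (a * u powi l)) * chi p (tr p 1 2 (b * u ^ N)))"
    unfolding S_def g_def by (rule sum.cong) (simp_all add: chi_add mem_n mem_2)
  also have "\<dots> = (\<Sum>v\<in>V. chi p (tr p 1 n (a * v))) * (\<Sum>w\<in>\<mu>\<^sub>4. chi p (tr p 1 2 (b * w)))"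
    by (rule sum_U_factor[OF l])
  finally have S: "S = (\<Sum>v\<in>V. chi p (tr p 1 n (a * v))) * (2 * C)"
    unfolding sum_mu4(1)[OF assms(9)] C_def .
  have "4 * (\<Sum>v\<in>V. chi p (tr p 1 n (a * v))) = X"
    unfolding assms(5,17) X_def sum_V[OF assms(15) odd_k] by (rule half_circle_sum[OF assms(15,16)])
  then have SX: "2 * S = X * C" unfolding S by (simp add: algebra_simps)
  \<comment> \<open>A quotient by 0 is 0 in HOL, so the final equivalence requires a nonzero
    denominator.\<close>
  have "2 * C \<noteq> 0" using sum_mu4(2)[OF assms(9)] unfolding sum_mu4(1)[OF assms(9)] C_def .
  then have C0: "C \<noteq> 0" by simp
  have "regular_bent p n f \<longleftrightarrow> S = 1"
    unfolding assms(5) by (rule regular_bent_iff[OF f_g f_0 _ S_def]) (auto simp: g_def intro: GF_add mem_n mem_2)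
  also have "\<dots> \<longleftrightarrow> X * C = 2"
    unfolding SX[symmetric] by auto
  also have "\<dots> \<longleftrightarrow> X = 2 / C"
    using C0 by (simp add: eq_divide_eq)
  also have "\<dots> \<longleftrightarrow> Kloost p m (abar ^ 2) =
      1 - 4 * Iconst p m * \<i> * complex_of_real (sin (2 * pi * real (Qfun p m abar) / real p)) - 2 / C"
    unfolding X_def by (auto simp: algebra_simps)
  finally show ?thesis unfolding C_def im .
qed

end
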